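(* $\mathsf{IGMP}(\omega_2)$ implies that there does not exist an $\omega_1$-Suslin tree, so the Suslin hypothesis holds.
   Context: $H(\omega_2)$ is the collection of sets of hereditary cardinality less than $\omega_2$, and $P_{\omega_2}(X)=\{a\subseteq X: |a|<\omega_2\}$. For a set $N$, a set $d\subseteq N$ is countably approximated by $N$ if for every $a\in N$ which $N$ models is countable, $d\cap a\in N$. A set $d\subseteq N$ is $N$-guessed if there is $e\in N$ with $d=e\cap N$. $N$ is $\omega_1$-guessing if every $d\subseteq N\cap \mathrm{On}$ with $\sup(d)<\sup(N\cap\mathrm{On})$ which is countably approximated by $N$ is $N$-guessed. $N$ is indestructibly $\omega_1$-guessing if every forcing poset which preserves $\omega_1$ forces that $N$ is $\omega_1$-guessing. $\mathsf{IGMP}(\omega_2)$ says that there are stationarily many $N\in P_{\omega_2}(H(\omega_2))$ which are indestructibly $\omega_1$-guessing. *)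

theory Defs
  imports "HOL-Library.Countable_Set"
begin

unbundle cardinal_syntax

section \<open>The universe of sets\<close>

text \<open>
  A type satisfying the axioms of ZFC, with Separation and Replacement for arbitrary HOL
  predicates and functions; Choice is inherited from HOL. Hence a subset of \<open>elts x\<close>, or a
  relation on it, is (coded by) a set of the universe, and cardinalities computed in HOL
  agree with those of the universe.
\<close>

class zfc =
  fixes elts :: "'a \<Rightarrow> 'a set"
  assumes extensionality: "elts x = elts y \<Longrightarrow> x = y"
    and foundation: "wf {(x, y). x \<in> elts y}"
    and pairing: "\<exists>z. elts z = {x, y}"
    and union: "\<exists>z. elts z = (\<Union>y\<in>elts x. elts y)"
    and powerset: "\<exists>z. elts z = {y. elts y \<subseteq> elts x}"
    and infinity: "\<exists>z. (\<exists>e\<in>elts z. elts e = {}) \<and>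
                      (\<forall>y\<in>elts z. \<exists>s\<in>elts z. elts s = insert y (elts y))"
    and separation: "\<exists>z. elts z = {y \<in> elts x. \<phi> y}"
    and replacement: "\<exists>z. elts z = f ` elts x"

definition set_of :: "'v set \<Rightarrow> 'v::zfc" where
  "set_of A = (THE z. elts z = A)"

definition vpair :: "'v \<Rightarrow> 'v \<Rightarrow> 'v::zfc" where
  "vpair x y = set_of {set_of {x}, set_of {x, y}}"

definition trcl :: "'v::zfc \<Rightarrow> 'v set" where
  "trcl x = {y. (y, x) \<in> {(a, b). a \<in> elts b}\<^sup>+}"


section \<open>Cardinals, \<open>H(\<omega>\<^sub>2)\<close> and stationarity\<close>

abbreviation omega1_card :: "nat set rel" where
  "omega1_card \<equiv> cardSuc natLeq"

abbreviation omega2_card :: "nat set set rel" where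
  "omega2_card \<equiv> cardSuc omega1_card"

definition H_omega2 :: "'v::zfc set" where
  "H_omega2 = {x. |trcl x| <o omega2_card}"

definition P_omega2 :: "'a set \<Rightarrow> 'a set set" where
  "P_omega2 X = {a. a \<subseteq> X \<and> |a| <o omega2_card}"

definition club_P_omega2 :: "'a set \<Rightarrow> 'a set set \<Rightarrow> bool" where
  "club_P_omega2 X C \<longleftrightarrow>
     C \<subseteq> P_omega2 X \<and>
     (\<forall>a\<in>P_omega2 X. \<exists>b\<in>C. a \<subseteq> b) \<and>
     (\<forall>D. D \<subseteq> C \<and> D \<noteq> {} \<and> chain\<^sub>\<subseteq> D \<and> |D| <o omega2_card \<longrightarrow> \<Union>D \<in> C)"

definition stationary_P_omega2 :: "'a set \<Rightarrow> 'a set set \<Rightarrow> bool" where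
  "stationary_P_omega2 X S \<longleftrightarrow>
     S \<subseteq> P_omega2 X \<and> (\<forall>C. club_P_omega2 X C \<longrightarrow> S \<inter> C \<noteq> {})"


section \<open>Interpretations of the language of set theory\<close>

text \<open>
  Formulas of set theory are written once, in higher-order abstract syntax over a record
  giving the meaning of the primitive symbols. They are then evaluated in the universe, in a
  forcing extension (where \<open>'t\<close> consists of predicates on conditions), and, through
  relativization of the quantifiers, in a set \<open>(N, \<in>)\<close> of either.
\<close>

record ('v, 't) interp =
  Mem :: "'v \<Rightarrow> 'v \<Rightarrow> 't"
  Eq :: "'v \<Rightarrow> 'v \<Rightarrow> 't"
  Neg :: "'t \<Rightarrow> 't"
  Conj :: "'t \<Rightarrow> 't \<Rightarrow> 't"
  Forall :: "('v \<Rightarrow> 't) \<Rightarrow> 't"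

type_synonym ('v, 't) fm1 = "('v, 't) interp \<Rightarrow> 'v \<Rightarrow> 't"
type_synonym ('v, 't) fm2 = "('v, 't) interp \<Rightarrow> 'v \<Rightarrow> 'v \<Rightarrow> 't"
type_synonym ('v, 't) fm3 = "('v, 't) interp \<Rightarrow> 'v \<Rightarrow> 'v \<Rightarrow> 'v \<Rightarrow> 't"

definition Disj :: "('v, 't) interp \<Rightarrow> 't \<Rightarrow> 't \<Rightarrow> 't" where
  "Disj I \<phi> \<psi> = Neg I (Conj I (Neg I \<phi>) (Neg I \<psi>))"

definition Imp :: "('v, 't) interp \<Rightarrow> 't \<Rightarrow> 't \<Rightarrow> 't" where
  "Imp I \<phi> \<psi> = Neg I (Conj I \<phi> (Neg I \<psi>))"

definition Iff :: "('v, 't) interp \<Rightarrow> 't \<Rightarrow> 't \<Rightarrow> 't" where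
  "Iff I \<phi> \<psi> = Conj I (Imp I \<phi> \<psi>) (Imp I \<psi> \<phi>)"

definition Exists :: "('v, 't) interp \<Rightarrow> ('v \<Rightarrow> 't) \<Rightarrow> 't" where
  "Exists I \<phi> = Neg I (Forall I (\<lambda>x. Neg I (\<phi> x)))"

definition ForallIn :: "('v, 't) interp \<Rightarrow> 'v \<Rightarrow> ('v \<Rightarrow> 't) \<Rightarrow> 't" where
  "ForallIn I a \<phi> = Forall I (\<lambda>x. Imp I (Mem I x a) (\<phi> x))"

definition ExistsIn :: "('v, 't) interp \<Rightarrow> 'v \<Rightarrow> ('v \<Rightarrow> 't) \<Rightarrow> 't" where
  "ExistsIn I a \<phi> = Exists I (\<lambda>x. Conj I (Mem I x a) (\<phi> x))"

text \<open>\<open>\<phi> (relativize I N)\<close> is the statement, in \<open>I\<close>, that \<open>(N, \<in>)\<close> satisfies \<open>\<phi>\<close>.\<close>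

definition relativize :: "('v, 't) interp \<Rightarrow> 'v \<Rightarrow> ('v, 't) interp" where
  "relativize I N = I\<lparr>Forall := ForallIn I N\<rparr>"

definition is_subset :: "('v, 't) fm2" where
  "is_subset I x y = ForallIn I x (\<lambda>z. Mem I z y)"

text \<open>\<open>z = {x, y}\<close>, \<open>z = (x, y)\<close>, \<open>z = x \<inter> y\<close> and \<open>z = \<Union>x\<close>, respectively.\<close>

definition is_upair :: "('v, 't) fm3" where
  "is_upair I z x y = Forall I (\<lambda>u. Iff I (Mem I u z) (Disj I (Eq I u x) (Eq I u y)))"

definition is_pair :: "('v, 't) fm3" where
  "is_pair I z x y =
     Forall I (\<lambda>u. Iff I (Mem I u z) (Disj I (is_upair I u x x) (is_upair I u x y)))"

definition is_inter :: "('v, 't) fm3" where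
  "is_inter I z x y = Forall I (\<lambda>u. Iff I (Mem I u z) (Conj I (Mem I u x) (Mem I u y)))"

definition is_union :: "('v, 't) fm2" where
  "is_union I z x = Forall I (\<lambda>u. Iff I (Mem I u z) (ExistsIn I x (\<lambda>y. Mem I u y)))"

definition is_transitive :: "('v, 't) fm1" where
  "is_transitive I x = ForallIn I x (\<lambda>y. is_subset I y x)"

definition is_ordinal :: "('v, 't) fm1" where
  "is_ordinal I x = Conj I (is_transitive I x) (ForallIn I x (is_transitive I))"

definition is_limit :: "('v, 't) fm1" where
  "is_limit I x =
     Conj I (is_ordinal I x)
    (Conj I (Exists I (\<lambda>y. Mem I y x))
            (ForallIn I x (\<lambda>y. ExistsIn I x (\<lambda>z. Mem I y z))))"

definition is_omega :: "('v, 't) fm1" where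
  "is_omega I x = Conj I (is_limit I x) (ForallIn I x (\<lambda>y. Neg I (is_limit I y)))"

text \<open>\<open>f\<close> is an injective function from \<open>a\<close> to \<open>b\<close>, as a set of ordered pairs.\<close>

definition maps_to :: "('v, 't) interp \<Rightarrow> 'v \<Rightarrow> 'v \<Rightarrow> 'v \<Rightarrow> 't" where
  "maps_to I f x y = ExistsIn I f (\<lambda>p. is_pair I p x y)"

definition is_injection :: "('v, 't) fm3" where
  "is_injection I f a b =
     Conj I (ForallIn I f (\<lambda>p. ExistsIn I a (\<lambda>x. ExistsIn I b (\<lambda>y. is_pair I p x y))))
    (Conj I (ForallIn I a (\<lambda>x. ExistsIn I b (\<lambda>y.
               ForallIn I b (\<lambda>y'. Iff I (maps_to I f x y') (Eq I y' y)))))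
            (ForallIn I a (\<lambda>x. ForallIn I a (\<lambda>x'. ForallIn I b (\<lambda>y.
               Imp I (Conj I (maps_to I f x y) (maps_to I f x' y)) (Eq I x x'))))))"

definition is_countable :: "('v, 't) fm1" where
  "is_countable I a =
     Exists I (\<lambda>w. Conj I (is_omega I w) (Exists I (\<lambda>f. is_injection I f a w)))"

definition is_omega1 :: "('v, 't) fm1" where
  "is_omega1 I x =
     Conj I (is_ordinal I x)
    (Conj I (Neg I (is_countable I x)) (ForallIn I x (is_countable I)))"


section \<open>Guessing\<close>

definition countably_approximated :: "('v, 't) fm2" where
  "countably_approximated I d N =
     Conj I (is_subset I d N)
            (ForallIn I N (\<lambda>a. Imp I (is_countable (relativize I N) a)
                                     (ExistsIn I N (\<lambda>x. is_inter I x d a))))"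

definition guessed :: "('v, 't) fm2" where
  "guessed I d N = ExistsIn I N (\<lambda>e. is_inter I d e N)"

text \<open>Here \<open>o' = N \<inter> On\<close>; the supremum of a set of ordinals is its union.\<close>

definition omega1_guessing :: "('v, 't) fm1" where
  "omega1_guessing I N =
     Forall I (\<lambda>o'. Imp I
       (Forall I (\<lambda>x. Iff I (Mem I x o') (Conj I (Mem I x N) (is_ordinal I x))))
       (Forall I (\<lambda>d. Imp I
         (Conj I (is_subset I d o')
         (Conj I (Exists I (\<lambda>s. Exists I (\<lambda>s'.
                    Conj I (is_union I s d) (Conj I (is_union I s' o') (Mem I s s')))))
                 (countably_approximated I d N)))
         (guessed I d N))))"


section \<open>Forcing\<close>

definition universe :: "('v::zfc, bool) interp" where
  "universe = \<lparr>Mem = (\<lambda>x y. x \<in> elts y), Eq = (=), Neg = Not, Conj = (\<and>),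
               Forall = (\<lambda>\<phi>. \<forall>x. \<phi> x)\<rparr>"

text \<open>
  A forcing poset is a set \<open>P\<close> with a relation \<open>r\<close>, where \<open>(q, p) \<in> r\<close> means that \<open>q\<close> is
  stronger than \<open>p\<close>. No greatest condition is assumed, so ``\<open>P\<close> forces'' means that every
  condition forces, and check names use all conditions.
\<close>

definition forcing_poset :: "'v::zfc \<Rightarrow> 'v rel \<Rightarrow> bool" where
  "forcing_poset P r \<longleftrightarrow> elts P \<noteq> {} \<and> partial_order_on (elts P) r"

inductive forcing_name :: "'v::zfc \<Rightarrow> 'v \<Rightarrow> bool" for P where
  "(\<And>x. x \<in> elts \<tau> \<Longrightarrow> \<exists>\<sigma> p. x = vpair \<sigma> p \<and> forcing_name P \<sigma> \<and> p \<in> elts P)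
     \<Longrightarrow> forcing_name P \<tau>"

definition check_name :: "'v::zfc \<Rightarrow> 'v \<Rightarrow> 'v" where
  "check_name P = wfrec {(x, y). x \<in> elts y}
     (\<lambda>check x. set_of {vpair (check y) p |y p. y \<in> elts x \<and> p \<in> elts P})"

lemma check_name_unfold:
  "check_name P x = set_of {vpair (check_name P y) p |y p. y \<in> elts x \<and> p \<in> elts P}"
  unfolding check_name_def
  by (subst wfrec[OF foundation])
     (auto simp: cut_def intro!: arg_cong[where f = set_of])

text \<open>
  The forcing relation for equality. The clauses are recursive on the rank of the first name,
  so that the least fixed point is the only one. Below, \<open>forces_mem\<close> is the usual clause for
  membership, in terms of which the two premises say that
  \<open>p\<close> forces \<open>\<tau> \<subseteq> \<theta>\<close> and \<open>\<theta> \<subseteq> \<tau>\<close>.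
\<close>

inductive forces_eq :: "'v rel \<Rightarrow> 'v \<Rightarrow> 'v \<Rightarrow> 'v::zfc \<Rightarrow> bool" for r where
  "\<lbrakk>\<And>\<sigma> s q. \<lbrakk>vpair \<sigma> s \<in> elts \<tau>; (q, p) \<in> r; (q, s) \<in> r\<rbrakk> \<Longrightarrow>
        \<exists>q' \<rho> t. (q', q) \<in> r \<and> vpair \<rho> t \<in> elts \<theta> \<and> (q', t) \<in> r \<and> forces_eq r q' \<sigma> \<rho>;
    \<And>\<rho> t q. \<lbrakk>vpair \<rho> t \<in> elts \<theta>; (q, p) \<in> r; (q, t) \<in> r\<rbrakk> \<Longrightarrow>
        \<exists>q' \<sigma> s. (q', q) \<in> r \<and> vpair \<sigma> s \<in> elts \<tau> \<and> (q', s) \<in> r \<and> forces_eq r q' \<sigma> \<rho>\<rbrakk>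
   \<Longrightarrow> forces_eq r p \<tau> \<theta>"

definition forces_mem :: "'v rel \<Rightarrow> 'v \<Rightarrow> 'v \<Rightarrow> 'v::zfc \<Rightarrow> bool" where
  "forces_mem r p \<sigma> \<theta> \<longleftrightarrow>
     (\<forall>q. (q, p) \<in> r \<longrightarrow>
        (\<exists>q' \<rho> t. (q', q) \<in> r \<and> vpair \<rho> t \<in> elts \<theta> \<and> (q', t) \<in> r \<and> forces_eq r q' \<sigma> \<rho>))"

text \<open>\<open>\<phi> (forcing P r) \<tau> p\<close> says that \<open>p\<close> forces \<open>\<phi>(\<tau>)\<close>.\<close>

definition forcing :: "'v::zfc \<Rightarrow> 'v rel \<Rightarrow> ('v, 'v \<Rightarrow> bool) interp" where
  "forcing P r =
     \<lparr>Mem = (\<lambda>\<sigma> \<tau> p. forces_mem r p \<sigma> \<tau>),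
      Eq = (\<lambda>\<sigma> \<tau> p. forces_eq r p \<sigma> \<tau>),
      Neg = (\<lambda>\<phi> p. \<forall>q. (q, p) \<in> r \<longrightarrow> \<not> \<phi> q),
      Conj = (\<lambda>\<phi> \<psi> p. \<phi> p \<and> \<psi> p),
      Forall = (\<lambda>\<phi> p. \<forall>\<tau>. forcing_name P \<tau> \<longrightarrow> \<phi> \<tau> p)\<rparr>"

definition omega1 :: "'v::zfc" where
  "omega1 = (THE x. is_omega1 universe x)"

definition preserves_omega1 :: "'v::zfc \<Rightarrow> 'v rel \<Rightarrow> bool" where
  "preserves_omega1 P r \<longleftrightarrow>
     (\<forall>p\<in>elts P. is_omega1 (forcing P r) (check_name P omega1) p)"

definition indestructibly_omega1_guessing :: "'v::zfc \<Rightarrow> bool" where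
  "indestructibly_omega1_guessing N \<longleftrightarrow>
     (\<forall>P r. forcing_poset P r \<and> preserves_omega1 P r \<longrightarrow>
        (\<forall>p\<in>elts P. omega1_guessing (forcing P r) (check_name P N) p))"

definition IGMP_omega2 :: "'v::zfc itself \<Rightarrow> bool" where
  "IGMP_omega2 _ \<longleftrightarrow>
     stationary_P_omega2 (H_omega2 :: 'v set)
       {elts N |N. elts N \<in> P_omega2 H_omega2 \<and> indestructibly_omega1_guessing N}"


section \<open>Suslin trees and the Suslin hypothesis\<close>

text \<open>The height of \<open>t\<close> in a tree, as a well-order.\<close>

definition height :: "'a rel \<Rightarrow> 'a \<Rightarrow> 'a rel" where
  "height r t = Restr r (underS r t)"

definition tree_on :: "'a set \<Rightarrow> 'a rel \<Rightarrow> bool" where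
  "tree_on T r \<longleftrightarrow>
     partial_order_on T r \<and> (\<forall>t\<in>T. well_order_on (underS r t) (height r t))"

definition antichain :: "'a rel \<Rightarrow> 'a set \<Rightarrow> bool" where
  "antichain r A \<longleftrightarrow> (\<forall>x\<in>A. \<forall>y\<in>A. x \<noteq> y \<longrightarrow> (x, y) \<notin> r \<and> (y, x) \<notin> r)"

text \<open>
  The first two clauses after \<open>tree_on\<close> say that the tree has height \<open>\<omega>\<^sub>1\<close>, that is, that its
  \<open>\<alpha>\<close>-th level is nonempty exactly when \<open>\<alpha> < \<omega>\<^sub>1\<close>.
\<close>

definition suslin_tree :: "'a set \<Rightarrow> 'a rel \<Rightarrow> bool" where
  "suslin_tree T r \<longleftrightarrow>
     tree_on T r \<and>
     (\<forall>t\<in>T. height r t <o omega1_card) \<and>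
     (\<forall>\<alpha> :: nat set rel. \<alpha> <o omega1_card \<longrightarrow> (\<exists>t\<in>T. height r t =o \<alpha>)) \<and>
     (\<forall>A\<subseteq>T. A \<in> Chains r \<longrightarrow> countable A) \<and>
     (\<forall>A\<subseteq>T. antichain r A \<longrightarrow> countable A)"

definition open_interval :: "'a rel \<Rightarrow> 'a \<Rightarrow> 'a \<Rightarrow> 'a set" where
  "open_interval r a b = {x. (a, x) \<in> r - Id \<and> (x, b) \<in> r - Id}"

definition nonempty_intervals :: "'a rel \<Rightarrow> 'a set set" where
  "nonempty_intervals r = {open_interval r a b |a b. open_interval r a b \<noteq> {}}"

text \<open>
  A Suslin line is a dense linear order which satisfies the countable chain condition and is
  not separable. The order being dense, it suffices to consider open intervals.
\<close>

definition suslin_line :: "'a set \<Rightarrow> 'a rel \<Rightarrow> bool" where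
  "suslin_line L r \<longleftrightarrow>
     linear_order_on L r \<and>
     (\<forall>a b. (a, b) \<in> r - Id \<longrightarrow> open_interval r a b \<noteq> {}) \<and>
     (\<forall>U \<subseteq> nonempty_intervals r. pairwise disjnt U \<longrightarrow> countable U) \<and>
     \<not> (\<exists>D\<subseteq>L. countable D \<and> (\<forall>J\<in>nonempty_intervals r. D \<inter> J \<noteq> {}))"

definition suslin_hypothesis :: "'v::zfc itself \<Rightarrow> bool" where
  "suslin_hypothesis _ \<longleftrightarrow> \<not> (\<exists>(L::'v) r. suslin_line (elts L) r)"

end

theory Submission
  imports Defs
begin

text \<open>
  From a Suslin tree or a Suslin line one obtains a forcing poset \<open>P \<subseteq> \<omega>\<^sub>1\<close> which is a tree upside
  down, has the countable chain condition, has no uncountable chain, and all of whose cones are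
  uncountable. By the countable chain condition \<open>P\<close> preserves \<open>\<omega>\<^sub>1\<close>. Stationarity provides an
  indestructibly \<open>\<omega>\<^sub>1\<close>-guessing \<open>N\<close> which is transitive, has \<open>\<omega>\<^sub>1 + 1\<close> as an element, and is
  closed under \<open>a \<mapsto> a \<inter> d\<^sub>t\<close>, where \<open>d\<^sub>t = {x. x \<le> t} \<union> {\<omega>\<^sub>1}\<close> for a node \<open>t\<close>. Let \<open>d\<close> be the generic
  branch together with \<open>\<omega>\<^sub>1\<close>. A countable \<open>a \<in> N\<close> cannot be cofinal in an uncountable cone, so some
  \<open>t\<close> in the generic branch decides \<open>d \<inter> a = a \<inter> d\<^sub>t \<in> N\<close>. Hence \<open>d\<close> is countably approximated,
  and so some condition forces \<open>d = e \<inter> N\<close> for some \<open>e \<in> N\<close>. Every node above that condition is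
  then an element of \<open>e\<close>, so that these nodes form an uncountable chain.
\<close>

section \<open>Sets, ordinals and countability in the universe\<close>

text \<open>Guessing concerns bounded sets of ordinals. Hence the nodes are made countable ordinals,
  and \<open>\<omega>\<^sub>1 + 1\<close> has to be in \<open>N\<close>: it puts the supremum
  \<open>omega1\<close> of the guessed set strictly below that of the ordinals of \<open>N\<close>.
  Whether \<open>N\<close> models that a set is countable is judged in the extension. Countability
  comes back to the universe because forcing adds no natural numbers, so that conditions decide the
  values of a name for an injection, and the countable chain condition bounds the number of such
  conditions. Formulas are functions of an interpretation, so there is no induction on formulas.
  Monotonicity, invariance under forced equality and absoluteness are instead rules for the single
  connectives, and each formula is treated by running through its syntax. No generic filter occurs:
  all statements are about conditions. A predicate on conditions that holds densely below
  \<open>p\<close> need not hold at \<open>p\<close>, so using an implication, and with it a bounded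
  quantifier, costs a passage to a stronger condition.\<close>

definition small :: "'v::zfc set \<Rightarrow> bool" where
  "small A \<longleftrightarrow> (\<exists>z. elts z = A)"

text \<open>\<open>set_of\<close> is a definite description, which says nothing about a proper
  class. Each use of it therefore rests on a proof of \<open>small\<close>.\<close>

lemma elts_set_of [simp]: "small A \<Longrightarrow> elts (set_of A) = A"
  unfolding small_def set_of_def by (rule theI') (auto intro: extensionality)

lemma small_elts [simp]: "small (elts x)"
  unfolding small_def by blast

lemma set_of_elts [simp]: "set_of (elts x) = x"
  by (rule extensionality) simp

lemma small_subset: "small A \<Longrightarrow> B \<subseteq> A \<Longrightarrow> small B"
proof -
  assume "small A" "B \<subseteq> A"
  then obtain x where "elts x = A" unfolding small_def by blast
  then have "{y \<in> elts x. y \<in> B} = B" using \<open>B \<subseteq> A\<close> by blast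
  then show "small B" using separation[of x "\<lambda>y. y \<in> B"] unfolding small_def by simp
qed

lemma small_empty [simp]: "small {}"
  using small_subset small_elts by blast

lemma small_image [simp]: "small A \<Longrightarrow> small (f ` A)" for f :: "'v \<Rightarrow> 'v::zfc"
  unfolding small_def using replacement[of f] by auto

lemma small_Union: "small A \<Longrightarrow> small (\<Union>y\<in>A. elts y)"
  unfolding small_def using union by auto

lemma small_UN:
  fixes F :: "'v \<Rightarrow> 'v::zfc set"
  assumes "small A" "\<And>x. x \<in> A \<Longrightarrow> small (F x)" shows "small (\<Union>x\<in>A. F x)"
proof -
  have "(\<Union>x\<in>A. F x) = (\<Union>y\<in>(\<lambda>x. set_of (F x)) ` A. elts y)" using assms(2) by auto
  then show ?thesis using small_Union[OF small_image[OF assms(1)]] by simp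
qed

lemma small_pair [simp]: "small {x, y}"
  using pairing unfolding small_def .

lemma small_Un [simp]: assumes "small A" "small B" shows "small (A \<union> B)"
proof -
  have "A \<union> B = (\<Union>y\<in>{set_of A, set_of B}. elts y)" using assms by auto
  then show ?thesis using small_Union[OF small_pair] by simp
qed

lemma small_insert [simp]: "small A \<Longrightarrow> small (insert x A)"
  using small_Un[OF small_pair[of x x], of A] by simp

lemma small_products: "small {vpair y p |y p. y \<in> elts x \<and> p \<in> elts P}"
proof -
  have "{vpair y p |y p. y \<in> elts x \<and> p \<in> elts P} = (\<Union>y\<in>elts x. vpair y ` elts P)" by auto
  then show ?thesis by (simp add: small_UN)
qed

lemma set_of_inject: "small A \<Longrightarrow> small B \<Longrightarrow> set_of A = set_of B \<longleftrightarrow> A = B"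
  using elts_set_of by metis

lemma eq_set_of_iff: "small A \<Longrightarrow> z = set_of A \<longleftrightarrow> elts z = A"
  using elts_set_of set_of_elts by metis

lemma vpair_inject [simp]: "vpair a b = vpair c d \<longleftrightarrow> a = c \<and> b = d"
  unfolding vpair_def by (simp add: set_of_inject doubleton_eq_iff) blast

lemma elts_induct [case_names step]:
  "(\<And>x. (\<And>y. y \<in> elts x \<Longrightarrow> Q y) \<Longrightarrow> Q x) \<Longrightarrow> Q x"
  using wf_induct[OF foundation, of Q x] by auto

lemma mem_irrefl: "x \<notin> elts x"
  using foundation wf_not_refl by fastforce

lemma mem_asym: "x \<in> elts y \<Longrightarrow> y \<notin> elts x"
  using wf_asym[OF foundation, of x y] by auto

section \<open>Transitive sets and ordinals\<close>

definition Transset :: "'v::zfc \<Rightarrow> bool" where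
  "Transset x \<longleftrightarrow> (\<forall>y\<in>elts x. elts y \<subseteq> elts x)"

definition Ord :: "'v::zfc \<Rightarrow> bool" where
  "Ord x \<longleftrightarrow> Transset x \<and> (\<forall>y\<in>elts x. Transset y)"

lemma Ord_in_Ord: "Ord x \<Longrightarrow> y \<in> elts x \<Longrightarrow> Ord y"
  unfolding Ord_def Transset_def by blast

lemma Ord_trans: "Ord x \<Longrightarrow> z \<in> elts y \<Longrightarrow> y \<in> elts x \<Longrightarrow> z \<in> elts x"
  unfolding Ord_def Transset_def by blast

text \<open>Double membership induction. If \<open>x\<close> and \<open>y\<close> were incomparable,
  the induction hypotheses would compare each element of one with the other set, transitivity would
  leave only membership, and extensionality would give \<open>x = y\<close>.\<close>

lemma Ord_linear: "Ord x \<Longrightarrow> Ord y \<Longrightarrow> x \<in> elts y \<or> x = y \<or> y \<in> elts x"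
proof (induction x arbitrary: y rule: elts_induct)
  case (step x)
  note x = step.IH step.prems(1)
  show ?case using step.prems(2)
  proof (induction y rule: elts_induct)
    case (step y)
    show ?case
    proof (rule ccontr)
      assume *: "\<not> ?case"
      have "elts x = elts y"
      proof (intro equalityI subsetI)
        fix z assume z: "z \<in> elts x"
        then have "z \<in> elts y \<or> z = y \<or> y \<in> elts z"
          using x Ord_in_Ord step.prems by blast
        then show "z \<in> elts y" using * z x(2) Ord_trans by blast
      next
        fix z assume z: "z \<in> elts y"
        then have "x \<in> elts z \<or> x = z \<or> z \<in> elts x"
          using step.IH Ord_in_Ord step.prems by blast
        then show "z \<in> elts x" using * z step.prems Ord_trans by blast
      qed
      then show False using * extensionality by blast
    qed
  qed
qed

section \<open>Finite ordinals and \<open>omega\<close>\<close>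

primrec num :: "nat \<Rightarrow> 'v::zfc" where
  "num 0 = set_of {}"
| "num (Suc n) = set_of (insert (num n) (elts (num n)))"

lemma elts_num: "elts (num n :: 'v::zfc) = num ` {..<n}"
proof (induction n)
  case (Suc n)
  have "elts (num (Suc n) :: 'v) = insert (num n) (elts (num n))" by simp
  then show ?case by (simp only: Suc lessThan_Suc image_insert)
qed simp

declare num.simps [simp del]

lemma num_inject [simp]: "num m = (num n :: 'v::zfc) \<longleftrightarrow> m = n"
proof -
  have "num m \<noteq> (num n :: 'v)" if "m < n" for m n
    using that mem_irrefl[of "num n :: 'v"] unfolding elts_num by (metis imageI lessThan_iff)
  then show ?thesis by (metis linorder_neqE_nat)
qed

lemma num_mem_iff [simp]: "num m \<in> elts (num n :: 'v::zfc) \<longleftrightarrow> m < n"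
  by (auto simp: elts_num)

definition omega :: "'v::zfc" where
  "omega = set_of (range num)"

text \<open>Replacement concerns maps from the universe to itself, whereas the domain of
  \<open>num\<close> is the type \<open>nat\<close>. The range is therefore cut out of the inductive
  set given by the axiom of infinity.\<close>

lemma small_range_num: "small (range num :: 'v::zfc set)"
proof -
  obtain z e :: 'v where z: "e \<in> elts z" "elts e = {}"
    "\<forall>y\<in>elts z. \<exists>s\<in>elts z. elts s = insert y (elts y)"
    using infinity by metis
  have "num n \<in> elts z" for n
  proof (induction n)
    case 0
    have "e = num 0" by (rule extensionality) (simp add: z elts_num)
    then show ?case using z by simp
  next
    case (Suc n)
    then obtain s where s: "s \<in> elts z" "elts s = insert (num n) (elts (num n))" using z by blast
    then have "s = num (Suc n)"
      by (intro extensionality) (simp add: elts_num lessThan_Suc)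
    then show ?case using s by simp
  qed
  then show ?thesis using small_subset[OF small_elts[of z]] by blast
qed

lemma elts_omega: "elts omega = range num"
  unfolding omega_def by (rule elts_set_of[OF small_range_num])

lemma Ord_omega: "Ord omega"
  unfolding Ord_def Transset_def by (auto simp: elts_num elts_omega)

section \<open>Formulas evaluated in the universe\<close>

lemma universe_simps [simp]:
  "Mem universe x y \<longleftrightarrow> x \<in> elts y" "Eq universe x y \<longleftrightarrow> x = y" "Neg universe b \<longleftrightarrow> \<not> b"
  "Conj universe b c \<longleftrightarrow> b \<and> c" "Forall universe \<phi> \<longleftrightarrow> (\<forall>x. \<phi> x)"
  "Disj universe b c \<longleftrightarrow> b \<or> c" "Imp universe b c \<longleftrightarrow> (b \<longrightarrow> c)" "Iff universe b c \<longleftrightarrow> b = c"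
  "Exists universe \<phi> \<longleftrightarrow> (\<exists>x. \<phi> x)" "ForallIn universe a \<phi> \<longleftrightarrow> (\<forall>x\<in>elts a. \<phi> x)"
  "ExistsIn universe a \<phi> \<longleftrightarrow> (\<exists>x\<in>elts a. \<phi> x)"
  unfolding universe_def Disj_def Imp_def Iff_def Exists_def ForallIn_def ExistsIn_def by auto

lemma is_ordinal_universe [simp]: "is_ordinal universe x \<longleftrightarrow> Ord x"
  unfolding is_ordinal_def is_transitive_def is_subset_def Ord_def Transset_def
  by (simp add: subset_eq)

lemma is_limit_omega: "is_limit universe omega"
  unfolding is_limit_def using Ord_omega by (auto simp: elts_omega elts_num)

text \<open>No numeral is a limit, so a set satisfying the formula is not an element of
  \<open>omega\<close>; nor can it have the limit \<open>omega\<close> as an element. Comparability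
  of ordinals leaves equality.\<close>

lemma is_omega_universe [simp]: "is_omega universe w \<longleftrightarrow> w = omega"
proof
  have not_limit: "\<not> is_limit universe (num n :: 'a)" for n
  proof
    assume lim: "is_limit universe (num n :: 'a)"
    then obtain k where k: "n = Suc k" by (cases n) (auto simp: is_limit_def elts_num)
    then have "(num k :: 'a) \<in> elts (num n)" by simp
    then have "\<exists>z\<in>elts (num n). (num k :: 'a) \<in> elts z" using lim by (simp add: is_limit_def)
    then show False using k by (auto simp: elts_num)
  qed
  then show "is_omega universe w" if "w = omega"
    using that is_limit_omega by (auto simp: is_omega_def elts_omega)
  assume w: "is_omega universe w"
  then have "Ord w" by (simp add: is_omega_def is_limit_def)
  moreover have "omega \<notin> elts w" using w is_limit_omega by (auto simp: is_omega_def)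
  moreover have "w \<notin> elts omega"
    using w not_limit by (auto simp: is_omega_def elts_omega)
  ultimately show "w = omega" using Ord_linear Ord_omega by blast
qed

lemma is_upair_universe [simp]: "is_upair universe z x y \<longleftrightarrow> z = set_of {x, y}"
  unfolding is_upair_def by (simp add: eq_set_of_iff set_eq_iff)

lemma is_pair_universe [simp]: "is_pair universe z x y \<longleftrightarrow> z = vpair x y"
  unfolding is_pair_def vpair_def by (simp add: eq_set_of_iff set_eq_iff)

lemma maps_to_universe [simp]: "maps_to universe f x y \<longleftrightarrow> vpair x y \<in> elts f"
  unfolding maps_to_def by auto

lemma injection_to_omega:
  assumes "countable (elts a)"
  obtains f where "is_injection universe f a omega"
proof -
  obtain g :: "'a \<Rightarrow> nat" where g: "inj_on g (elts a)" using assms countableE by blast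
  define f where "f = set_of ((\<lambda>x. vpair x (num (g x))) ` elts a)"
  have f: "elts f = (\<lambda>x. vpair x (num (g x))) ` elts a" unfolding f_def by simp
  show ?thesis
  proof (rule that[of f])
    have "\<forall>x\<in>elts a. \<exists>y\<in>elts omega. \<forall>y'\<in>elts omega. (vpair x y' \<in> elts f) = (y' = y)"
      unfolding f elts_omega by (auto simp: image_iff)
    moreover have "x = x'"
      if "x \<in> elts a" "x' \<in> elts a" "vpair x y \<in> elts f" "vpair x' y \<in> elts f" for x x' y
      using that inj_onD[OF g, of x x'] by (auto simp: f)
    moreover have "\<forall>p\<in>elts f. \<exists>x\<in>elts a. \<exists>y\<in>elts omega. p = vpair x y"
      unfolding f elts_omega by blast
    ultimately show "is_injection universe f a omega"
      unfolding is_injection_def by simp blast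
  qed
qed

lemma is_countable_universe [simp]: "is_countable universe a \<longleftrightarrow> countable (elts a)"
proof
  assume "is_countable universe a"
  then obtain f where f: "is_injection universe f a omega" by (auto simp: is_countable_def)
  then have "\<forall>x\<in>elts a. \<exists>n. vpair x (num n) \<in> elts f"
    by (auto simp: is_injection_def elts_omega)
  then obtain g where g: "\<And>x. x \<in> elts a \<Longrightarrow> vpair x (num (g x)) \<in> elts f" by metis
  then have "inj_on g (elts a)" using f by (intro inj_onI) (auto simp: is_injection_def elts_omega, metis)
  then show "countable (elts a)" by (rule countableI)
next
  assume "countable (elts a)"
  then show "is_countable universe a"
    using injection_to_omega unfolding is_countable_def by (metis universe_simps(4,9) is_omega_universe)
qed

section \<open>Countability in terms of cardinals, and the ordinal \<open>omega1\<close>\<close>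

lemma Well_order_omega1_card: "Well_order omega1_card"
  and Card_order_omega1_card: "Card_order omega1_card"
  using cardSuc_Well_order cardSuc_Card_order natLeq_Card_order by blast+

lemma countable_iff_less_omega1: "countable A \<longleftrightarrow> |A| <o omega1_card"
proof -
  have "countable A \<longleftrightarrow> |A| \<le>o |UNIV :: nat set|"
    unfolding countable_def card_of_ordLeq[symmetric] by auto
  also have "\<dots> \<longleftrightarrow> |A| \<le>o natLeq"
    using card_of_nat ordLeq_ordIso_trans ordIso_symmetric by blast
  also have "\<dots> \<longleftrightarrow> |A| <o omega1_card"
    using cardSuc_ordLeq_ordLess[OF natLeq_Card_order card_of_Card_order] by blast
  finally show ?thesis .
qed

lemma uncountable_iff_omega1_le: "uncountable A \<longleftrightarrow> omega1_card \<le>o |A|"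
  using countable_iff_less_omega1 Well_order_omega1_card card_of_Well_order
  by (metis not_ordLeq_iff_ordLess)

lemma less_omega2_iff: "|A| <o omega2_card \<longleftrightarrow> |A| \<le>o omega1_card"
  using cardSuc_ordLeq_ordLess[OF Card_order_omega1_card card_of_Card_order] by blast

text \<open>The ordinal \<open>\<omega>\<^sub>1\<close> is obtained as the Mostowski collapse of the well-order
  \<^const>\<open>cardSuc\<close>~\<^const>\<open>natLeq\<close>.\<close>

lemma ex_omega1:
  "\<exists>x::'v::zfc. is_omega1 universe x \<and> |elts x| =o omega1_card"
proof -
  define R where "R = omega1_card - Id"
  interpret wo_rel omega1_card using Well_order_omega1_card by (simp add: wo_rel_def)
  have R: "wf R" "trans R" "total_on (Field omega1_card) R"
    using WF TRANS ANTISYM TOTAL unfolding R_def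
    by (auto simp: well_order_on_def total_on_def intro: trans_diff_Id)
  have under: "Order_Relation.underS omega1_card a = {b. (b, a) \<in> R}" for a unfolding R_def Order_Relation.underS_def by auto
  define col :: "nat set \<Rightarrow> 'v" where
    "col = wfrec R (\<lambda>f a. set_of (f ` Order_Relation.underS omega1_card a))"
  have col_unfold: "col a = set_of (col ` Order_Relation.underS omega1_card a)" for a
    unfolding col_def by (subst wfrec[OF R(1)])
      (auto simp: cut_def under intro!: arg_cong[where f = set_of])
  \<comment> \<open>The type \<open>nat set\<close> is not part of the universe, but a set of
    naturals is coded by a subset of \<open>omega\<close>; so the range is contained in an image of
    the power set of \<open>omega\<close>.\<close>
  have small_range: "small (range g)" for g :: "nat set \<Rightarrow> 'v"
  proof -
    obtain z :: 'v where z: "elts z = {y. elts y \<subseteq> elts omega}" using powerset by blast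
    have "range g \<subseteq> (\<lambda>y. g (num -` elts y)) ` elts z"
    proof safe
      fix A
      have sm: "small (num ` A :: 'v set)"
        by (rule small_subset[OF small_range_num]) blast
      then have "set_of (num ` A) \<in> elts z" using z by (auto simp: elts_omega)
      moreover have "g A = g (num -` elts (set_of (num ` A) :: 'v))"
        using sm by (auto intro!: arg_cong[where f = g])
      ultimately show "g A \<in> (\<lambda>y. g (num -` elts y)) ` elts z" by blast
    qed
    then show ?thesis using small_subset[OF small_image[OF small_elts]] by blast
  qed
  then have "small (col ` A)" for A by (meson image_mono small_subset subset_UNIV)
  then have elts_col: "elts (col a) = col ` Order_Relation.underS omega1_card a" for a
    using col_unfold by (metis elts_set_of)
  define x where "x = set_of (col ` Field omega1_card)"
  have elts_x: "elts x = col ` Field omega1_card"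
    unfolding x_def using \<open>\<And>A. small (col ` A)\<close> by simp
  have trans_col: "Transset (col a)" for a
    unfolding Transset_def elts_col under using transD[OF R(2)] by (auto simp: elts_col under)
  have "Ord x"
    unfolding Ord_def using trans_col
    by (auto simp: elts_x Transset_def elts_col Order_Relation.underS_def Field_def)
  have inj: "inj_on col (Field omega1_card)"
  proof (rule inj_onI, rule ccontr)
    fix a b assume ab: "a \<in> Field omega1_card" "b \<in> Field omega1_card" "col a = col b" "a \<noteq> b"
    then have "(a, b) \<in> R \<or> (b, a) \<in> R" using R(3) by (auto simp: total_on_def)
    then have "col a \<in> elts (col b) \<or> col b \<in> elts (col a)" unfolding elts_col under by blast
    then show False using ab mem_irrefl by metis
  qed
  have "|elts x| =o |Field omega1_card|"
    unfolding elts_x using inj card_of_ordIsoI[of col] ordIso_symmetric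
    by (metis inj_on_imp_bij_betw)
  then have card: "|elts x| =o omega1_card"
    using card_of_Field_ordIso[OF Card_order_omega1_card] ordIso_transitive by blast
  have "uncountable (elts x)"
    unfolding uncountable_iff_omega1_le using card ordIso_imp_ordLeq ordIso_symmetric by blast
  moreover have "countable (elts y)" if "y \<in> elts x" for y
  proof -
    obtain a where a: "y = col a" "a \<in> Field omega1_card" using \<open>y \<in> elts x\<close> elts_x by auto
    then have "countable (Order_Relation.underS omega1_card a)"
      using card_of_underS[OF Card_order_omega1_card] countable_iff_less_omega1 by blast
    then show ?thesis unfolding a elts_col by simp
  qed
  ultimately have "is_omega1 universe x" using \<open>Ord x\<close> by (simp add: is_omega1_def)
  then show ?thesis using card by blast
qed

text \<open>Of two different candidates one would be an element of the other and hence countable.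
  Uniqueness gives the description \<open>omega1\<close> its meaning.\<close>

lemma is_omega1_unique: "is_omega1 universe x \<Longrightarrow> is_omega1 universe y \<Longrightarrow> x = y"
  using Ord_linear[of x y] by (auto simp: is_omega1_def)

lemma is_omega1_omega1: "is_omega1 universe (omega1 :: 'v::zfc)"
  and card_omega1: "|elts (omega1 :: 'v)| =o omega1_card"
proof -
  obtain x :: 'v where x: "is_omega1 universe x" "|elts x| =o omega1_card" using ex_omega1 by blast
  then have "omega1 = x" unfolding omega1_def using is_omega1_unique by blast
  then show "is_omega1 universe (omega1 :: 'v)" "|elts (omega1 :: 'v)| =o omega1_card"
    using x by simp_all
qed

lemma Ord_omega1: "Ord omega1"
  and uncountable_omega1: "uncountable (elts omega1)"
  and countable_in_omega1: "x \<in> elts omega1 \<Longrightarrow> countable (elts x)"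
  using is_omega1_omega1 by (auto simp: is_omega1_def)

section \<open>The forcing relation\<close>

lemma elts_check_name:
  "elts (check_name P x) = {vpair (check_name P y) p |y p. y \<in> elts x \<and> p \<in> elts P}"
proof -
  have "{vpair (check_name P y) p |y p. y \<in> elts x \<and> p \<in> elts P}
      = (\<Union>y\<in>elts x. vpair (check_name P y) ` elts P)"
    by auto
  then have "small {vpair (check_name P y) p |y p. y \<in> elts x \<and> p \<in> elts P}"
    by (simp add: small_UN)
  then show ?thesis by (subst check_name_unfold) simp
qed

locale forcing_notion =
  fixes P :: "'v::zfc" and r :: "'v rel"
  assumes poset: "forcing_poset P r"
begin

abbreviation leq :: "'v \<Rightarrow> 'v \<Rightarrow> bool" (infix \<open>\<preceq>\<close> 50) where
  "q \<preceq> p \<equiv> (q, p) \<in> r"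

abbreviation chk :: "'v \<Rightarrow> 'v" where
  "chk \<equiv> check_name P"

abbreviation F :: "('v, 'v \<Rightarrow> bool) interp" where
  "F \<equiv> forcing P r"

abbreviation E :: "'v \<Rightarrow> 'v \<Rightarrow> 'v \<Rightarrow> bool" where
  "E \<equiv> forces_eq r"

abbreviation M :: "'v \<Rightarrow> 'v \<Rightarrow> 'v \<Rightarrow> bool" where
  "M \<equiv> forces_mem r"

lemma refl: "p \<in> elts P \<Longrightarrow> p \<preceq> p"
  and trans: "p \<preceq> q \<Longrightarrow> q \<preceq> s \<Longrightarrow> p \<preceq> s"
  and leqD: "p \<preceq> q \<Longrightarrow> p \<in> elts P" "p \<preceq> q \<Longrightarrow> q \<in> elts P"
  using poset unfolding forcing_poset_def partial_order_on_def preorder_on_def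
  by (auto simp: refl_on_def dest: transD)

section \<open>Forced equality and membership\<close>

lemma E_iff:
  "E p \<tau> \<theta> \<longleftrightarrow>
    (\<forall>\<sigma> s q. vpair \<sigma> s \<in> elts \<tau> \<longrightarrow> q \<preceq> p \<longrightarrow> q \<preceq> s \<longrightarrow>
      (\<exists>q' \<rho> t. q' \<preceq> q \<and> vpair \<rho> t \<in> elts \<theta> \<and> q' \<preceq> t \<and> E q' \<sigma> \<rho>)) \<and>
    (\<forall>\<rho> t q. vpair \<rho> t \<in> elts \<theta> \<longrightarrow> q \<preceq> p \<longrightarrow> q \<preceq> t \<longrightarrow>
      (\<exists>q' \<sigma> s. q' \<preceq> q \<and> vpair \<sigma> s \<in> elts \<tau> \<and> q' \<preceq> s \<and> E q' \<sigma> \<rho>))"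
  by (subst forces_eq.simps) blast

lemma E_mono:
  assumes "E p \<tau> \<theta>" "q \<preceq> p"
  shows "E q \<tau> \<theta>"
  unfolding E_iff[of q]
proof (intro conjI allI impI)
  fix \<sigma> s q1 assume "vpair \<sigma> s \<in> elts \<tau>" "q1 \<preceq> q" "q1 \<preceq> s"
  then show "\<exists>q' \<rho> t. q' \<preceq> q1 \<and> vpair \<rho> t \<in> elts \<theta> \<and> q' \<preceq> t \<and> E q' \<sigma> \<rho>"
    using assms(1)[unfolded E_iff[of p]] trans[OF _ assms(2)] by blast
next
  fix \<sigma> s q1 assume "vpair \<sigma> s \<in> elts \<theta>" "q1 \<preceq> q" "q1 \<preceq> s"
  then show "\<exists>q' \<rho> t. q' \<preceq> q1 \<and> vpair \<rho> t \<in> elts \<tau> \<and> q' \<preceq> t \<and> E q' \<rho> \<sigma>"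
    using assms(1)[unfolded E_iff[of p]] trans[OF _ assms(2)] by blast
qed

lemma M_mono: "M p \<sigma> \<theta> \<Longrightarrow> q \<preceq> p \<Longrightarrow> M q \<sigma> \<theta>"
  unfolding forces_mem_def using trans by blast

text \<open>Membership has density built into its definition. This lets many arguments that only
  succeed at stronger conditions be brought back to \<open>p\<close>.\<close>

lemma M_dense:
  assumes "\<And>q. q \<preceq> p \<Longrightarrow> \<exists>q'. q' \<preceq> q \<and> M q' \<sigma> \<theta>" "p \<in> elts P"
  shows "M p \<sigma> \<theta>"
  unfolding forces_mem_def
proof (intro allI impI)
  fix q assume "q \<preceq> p"
  then obtain q' where q': "q' \<preceq> q" "M q' \<sigma> \<theta>" using assms by blast
  then have "q' \<preceq> q'" using refl leqD by blast
  with q' show "\<exists>q' \<rho> t. q' \<preceq> q \<and> vpair \<rho> t \<in> elts \<theta> \<and> q' \<preceq> t \<and> E q' \<sigma> \<rho>"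
    using trans unfolding forces_mem_def by blast
qed

text \<open>With Kuratowski pairs, \<open>\<sigma>\<close> is joined to \<open>\<tau>\<close> by a
  membership chain through \<open>{\<sigma>}\<close> and the pair, so induction on names follows
  from foundation.\<close>

lemma vpair_wf: "wf {(\<sigma>, \<tau>). \<exists>s. vpair \<sigma> s \<in> elts (\<tau> :: 'v)}"
proof -
  have "wf ({(x, y). x \<in> elts (y :: 'v)}\<^sup>+)" using foundation by (rule wf_trancl)
  moreover have "{(\<sigma>, \<tau>). \<exists>s. vpair \<sigma> s \<in> elts (\<tau> :: 'v)} \<subseteq> {(x, y). x \<in> elts (y :: 'v)}\<^sup>+"
  proof clarify
    fix \<sigma> \<tau> s :: 'v assume s: "vpair \<sigma> s \<in> elts \<tau>"
    have "\<sigma> \<in> elts (set_of {\<sigma>})" "set_of {\<sigma>} \<in> elts (vpair \<sigma> s)" unfolding vpair_def by auto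
    with s show "(\<sigma>, \<tau>) \<in> {(x, y). x \<in> elts y}\<^sup>+"
      by (meson CollectI case_prodI trancl.intros)
  qed
  ultimately show ?thesis by (rule wf_subset)
qed

lemma E_refl: "E p \<tau> \<tau>"
proof (induction \<tau> arbitrary: p rule: wf_induct_rule[OF vpair_wf])
  case (1 \<tau>)
  then have IH: "E q \<sigma> \<sigma>" if "vpair \<sigma> s \<in> elts \<tau>" for \<sigma> s q using that by blast
  show ?case unfolding E_iff[of p] using IH refl leqD by blast
qed

lemma E_sym: "E p \<tau> \<theta> \<Longrightarrow> E p \<theta> \<tau>"
proof (induction rule: forces_eq.induct)
  case (1 \<tau> p \<theta>)
  show ?case unfolding E_iff[of p \<theta>] using 1 by (intro conjI allI impI) metis+
qed

lemma E_trans: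
  assumes "E p \<tau> \<theta>" "E p \<theta> \<eta>"
  shows "E p \<tau> \<eta>"
proof -
  \<comment> \<open>The induction is on the first equality alone. The condition and the third name
    change on the way down to elements, so the claim is generalized over both.\<close>
  have "\<forall>q \<eta>. q \<preceq> p \<longrightarrow> E q \<theta> \<eta> \<longrightarrow> E q \<tau> \<eta>"
    using assms(1)
  proof (induction rule: forces_eq.induct)
    case (1 \<tau> p \<theta>)
    show ?case
    proof (intro allI impI)
      fix q \<eta> assume q: "q \<preceq> p" "E q \<theta> \<eta>"
      show "E q \<tau> \<eta>"
        unfolding E_iff[of q \<tau>]
      proof (intro conjI allI impI)
        fix \<sigma> s q1 assume "vpair \<sigma> s \<in> elts \<tau>" "q1 \<preceq> q" "q1 \<preceq> s"
        then obtain q2 \<rho> t where 2: "q2 \<preceq> q1" "vpair \<rho> t \<in> elts \<theta>" "q2 \<preceq> t"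
          "\<forall>q \<eta>. q \<preceq> q2 \<longrightarrow> E q \<rho> \<eta> \<longrightarrow> E q \<sigma> \<eta>"
          using 1(1)[of \<sigma> s q1] q trans by blast
        moreover have "q2 \<preceq> q" using 2 \<open>q1 \<preceq> q\<close> trans by blast
        ultimately obtain q3 \<pi> u where "q3 \<preceq> q2" "vpair \<pi> u \<in> elts \<eta>" "q3 \<preceq> u" "E q3 \<rho> \<pi>"
          using q(2)[unfolded E_iff[of q]] by blast
        then show "\<exists>q' \<rho> t. q' \<preceq> q1 \<and> vpair \<rho> t \<in> elts \<eta> \<and> q' \<preceq> t \<and> E q' \<sigma> \<rho>"
          using 2 trans by blast
      next
        fix \<pi> u q1 assume "vpair \<pi> u \<in> elts \<eta>" "q1 \<preceq> q" "q1 \<preceq> u"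
        then obtain q2 \<rho> t where 2: "q2 \<preceq> q1" "vpair \<rho> t \<in> elts \<theta>" "q2 \<preceq> t" "E q2 \<rho> \<pi>"
          using q(2)[unfolded E_iff[of q]] by blast
        moreover have "q2 \<preceq> p" using 2 \<open>q1 \<preceq> q\<close> q trans by blast
        ultimately obtain q3 \<sigma> s where 3: "q3 \<preceq> q2" "vpair \<sigma> s \<in> elts \<tau>" "q3 \<preceq> s"
          "\<forall>q \<eta>. q \<preceq> q3 \<longrightarrow> E q \<rho> \<eta> \<longrightarrow> E q \<sigma> \<eta>"
          using 1(2)[of \<rho> t q2] by blast
        moreover have "E q3 \<rho> \<pi>" "q3 \<preceq> q3" using 2 3 E_mono refl leqD by blast+
        ultimately show "\<exists>q' \<sigma> s. q' \<preceq> q1 \<and> vpair \<sigma> s \<in> elts \<tau> \<and> q' \<preceq> s \<and> E q' \<sigma> \<pi>"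
          using 2 trans by blast
      qed
    qed
  qed
  \<comment> \<open>\<open>p\<close> is not assumed to be a condition. Outside \<open>P\<close>
    nothing lies below \<open>p\<close>, and every equality is forced vacuously.\<close>
  moreover have "p \<preceq> p \<or> (\<forall>q. \<not> q \<preceq> p)" using refl leqD by blast
  moreover have "E p \<tau> \<eta>" if "\<forall>q. \<not> q \<preceq> p" using that unfolding E_iff[of p] by blast
  ultimately show ?thesis using assms(2) by blast
qed

lemma M_cong:
  assumes "M p \<sigma> \<theta>" "E p \<sigma> \<sigma>'" "E p \<theta> \<theta>'"
  shows "M p \<sigma>' \<theta>'"
  unfolding forces_mem_def
proof (intro allI impI)
  fix q assume q: "q \<preceq> p"
  then obtain q1 \<rho> t where 1: "q1 \<preceq> q" "vpair \<rho> t \<in> elts \<theta>" "q1 \<preceq> t" "E q1 \<sigma> \<rho>"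
    using assms(1) unfolding forces_mem_def by blast
  have "q1 \<preceq> p" using 1 q trans by blast
  then obtain q2 \<rho>' t' where 2: "q2 \<preceq> q1" "vpair \<rho>' t' \<in> elts \<theta>'" "q2 \<preceq> t'" "E q2 \<rho> \<rho>'"
    using 1 assms(3)[unfolded E_iff[of p]] by blast
  have "q2 \<preceq> p" "E q2 \<sigma> \<rho>" using 1 2 \<open>q1 \<preceq> p\<close> trans E_mono by blast+
  then have "E q2 \<sigma>' \<rho>'"
    using E_trans[OF E_sym[OF E_mono[OF assms(2)]] E_trans[OF _ 2(4)]] by blast
  then show "\<exists>q' \<rho> t. q' \<preceq> q \<and> vpair \<rho> t \<in> elts \<theta>' \<and> q' \<preceq> t \<and> E q' \<sigma>' \<rho>"
    using 1 2 trans by blast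
qed

lemma M_elim:
  assumes "M p \<sigma> \<theta>" "p \<in> elts P"
  obtains q \<rho> t where "q \<preceq> p" "vpair \<rho> t \<in> elts \<theta>" "q \<preceq> t" "E q \<sigma> \<rho>"
  using assms refl unfolding forces_mem_def by blast

lemma M_intro: "vpair \<sigma> s \<in> elts \<tau> \<Longrightarrow> q \<preceq> s \<Longrightarrow> M q \<sigma> \<tau>"
  unfolding forces_mem_def using E_refl refl trans leqD by blast

lemma E_ext:
  assumes "\<And>\<sigma> s q. vpair \<sigma> s \<in> elts \<tau> \<Longrightarrow> q \<preceq> p \<Longrightarrow> q \<preceq> s \<Longrightarrow> M q \<sigma> \<theta>"
    and "\<And>\<sigma> s q. vpair \<sigma> s \<in> elts \<theta> \<Longrightarrow> q \<preceq> p \<Longrightarrow> q \<preceq> s \<Longrightarrow> M q \<sigma> \<tau>"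
  shows "E p \<tau> \<theta>"
  unfolding E_iff[of p]
  using assms M_elim E_sym leqD by (intro conjI allI impI) metis+

section \<open>Check names\<close>

lemma M_check_intro: "y \<in> elts x \<Longrightarrow> p \<in> elts P \<Longrightarrow> M p (chk y) (chk x)"
  by (rule M_intro[where s = p]) (auto simp: elts_check_name refl)

lemma M_check_elim:
  assumes "M p \<sigma> (chk x)" "p \<in> elts P"
  obtains q y where "q \<preceq> p" "y \<in> elts x" "E q \<sigma> (chk y)"
  using assms by (elim M_elim) (auto simp: elts_check_name)

text \<open>Membership induction: below some stronger condition an element of one set is forced
  equal to an element of the other, and the induction hypothesis, which ranges over all conditions,
  turns this into true equality.\<close>

lemma E_check_iff: "p \<in> elts P \<Longrightarrow> E p (chk x) (chk y) \<longleftrightarrow> x = y"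
proof
  show "p \<in> elts P \<Longrightarrow> E p (chk x) (chk y) \<Longrightarrow> x = y"
  proof (induction x arbitrary: y p rule: elts_induct)
    case (step x)
    have "elts x = elts y"
    proof (intro equalityI subsetI)
      fix z assume z: "z \<in> elts x"
      then have "M p (chk z) (chk y)"
        using M_check_intro M_cong E_refl step.prems by blast
      then obtain q w where "q \<preceq> p" "w \<in> elts y" "E q (chk z) (chk w)"
        using M_check_elim step.prems by blast
      then show "z \<in> elts y" using step.IH[OF z] leqD by metis
    next
      fix w assume w: "w \<in> elts y"
      then have "M p (chk w) (chk x)"
        using M_check_intro M_cong E_refl E_sym step.prems by blast
      then obtain q z where "q \<preceq> p" "z \<in> elts x" "E q (chk w) (chk z)"
        using M_check_elim step.prems by blast
      then show "w \<in> elts x" using step.IH leqD E_sym by metis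
    qed
    then show ?case by (rule extensionality)
  qed
qed (simp add: E_refl)

lemma M_check_iff: "p \<in> elts P \<Longrightarrow> M p (chk y) (chk x) \<longleftrightarrow> y \<in> elts x"
  using M_check_intro M_check_elim E_check_iff leqD by metis

lemma name_check [simp]: "forcing_name P (chk x)"
proof (induction x rule: elts_induct)
  case (step x)
  show ?case
    by (rule forcing_name.intros) (use step in \<open>auto simp: elts_check_name\<close>)
qed

lemma name_dom:
  assumes "forcing_name P \<tau>" "vpair \<sigma> s \<in> elts \<tau>"
  shows "forcing_name P \<sigma>"
proof -
  obtain \<sigma>' p where "vpair \<sigma> s = vpair \<sigma>' p" "forcing_name P \<sigma>'"
    using assms by (blast elim: forcing_name.cases)
  then show ?thesis by simp
qed

subsection \<open>Formulas\<close>

lemma F_simps [simp]: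
  "Mem F \<sigma> \<tau> p \<longleftrightarrow> M p \<sigma> \<tau>" "Eq F \<sigma> \<tau> p \<longleftrightarrow> E p \<sigma> \<tau>"
  "Neg F \<phi> p \<longleftrightarrow> (\<forall>q. q \<preceq> p \<longrightarrow> \<not> \<phi> q)" "Conj F \<phi> \<psi> p \<longleftrightarrow> \<phi> p \<and> \<psi> p"
  "Forall F \<Phi> p \<longleftrightarrow> (\<forall>\<tau>. forcing_name P \<tau> \<longrightarrow> \<Phi> \<tau> p)"
  unfolding forcing_def by auto

lemma Imp_F: "Imp F \<phi> \<psi> p \<longleftrightarrow> (\<forall>q. q \<preceq> p \<longrightarrow> \<phi> q \<longrightarrow> (\<exists>q'. q' \<preceq> q \<and> \<psi> q'))"
  unfolding Imp_def by auto

lemma Imp_F_elim: "Imp F \<phi> \<psi> p \<Longrightarrow> \<phi> p \<Longrightarrow> p \<in> elts P \<Longrightarrow> \<exists>q. q \<preceq> p \<and> \<psi> q"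
  unfolding Imp_F using refl by blast

lemma Forall_F_elim: "Forall F \<Phi> p \<Longrightarrow> forcing_name P \<tau> \<Longrightarrow> \<Phi> \<tau> p"
  by simp

lemma Iff_F:
  "Iff F \<phi> \<psi> p \<longleftrightarrow>
    (\<forall>q. q \<preceq> p \<longrightarrow> \<phi> q \<longrightarrow> (\<exists>q'. q' \<preceq> q \<and> \<psi> q')) \<and>
    (\<forall>q. q \<preceq> p \<longrightarrow> \<psi> q \<longrightarrow> (\<exists>q'. q' \<preceq> q \<and> \<phi> q'))"
  unfolding Iff_def by (simp add: Imp_F)

lemma Disj_F: "Disj F \<phi> \<psi> p \<longleftrightarrow> (\<forall>q. q \<preceq> p \<longrightarrow> (\<exists>q'. q' \<preceq> q \<and> (\<phi> q' \<or> \<psi> q')))"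
  unfolding Disj_def by auto

lemma Exists_F:
  "Exists F \<Phi> p \<longleftrightarrow> (\<forall>q. q \<preceq> p \<longrightarrow> (\<exists>q' \<sigma>. q' \<preceq> q \<and> forcing_name P \<sigma> \<and> \<Phi> \<sigma> q'))"
  unfolding Exists_def by simp blast

lemma ForallIn_F:
  "ForallIn F a \<Phi> p \<longleftrightarrow>
    (\<forall>\<sigma> q. forcing_name P \<sigma> \<longrightarrow> q \<preceq> p \<longrightarrow> M q \<sigma> a \<longrightarrow> (\<exists>q'. q' \<preceq> q \<and> \<Phi> \<sigma> q'))"
  unfolding ForallIn_def by (auto simp: Imp_F)

lemma ExistsIn_F:
  "ExistsIn F a \<Phi> p \<longleftrightarrow>
    (\<forall>q. q \<preceq> p \<longrightarrow> (\<exists>q' \<sigma>. q' \<preceq> q \<and> forcing_name P \<sigma> \<and> M q' \<sigma> a \<and> \<Phi> \<sigma> q'))"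
  unfolding ExistsIn_def by (auto simp: Exists_F)

lemma ExistsIn_F_intro:
  assumes "forcing_name P \<sigma>" "\<And>q. q \<preceq> p \<Longrightarrow> M q \<sigma> a \<and> \<Phi> \<sigma> q"
  shows "ExistsIn F a \<Phi> p"
  unfolding ExistsIn_F using assms refl leqD by blast

definition mono :: "('v \<Rightarrow> bool) \<Rightarrow> bool" where
  "mono \<phi> \<longleftrightarrow> (\<forall>p q. q \<preceq> p \<longrightarrow> \<phi> p \<longrightarrow> \<phi> q)"

definition equiv_below :: "'v \<Rightarrow> ('v \<Rightarrow> bool) \<Rightarrow> ('v \<Rightarrow> bool) \<Rightarrow> bool" where
  "equiv_below p \<phi> \<psi> \<longleftrightarrow> (\<forall>q. q \<preceq> p \<longrightarrow> \<phi> q = \<psi> q)"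

lemma monoD: "mono \<phi> \<Longrightarrow> \<phi> p \<Longrightarrow> q \<preceq> p \<Longrightarrow> \<phi> q"
  unfolding mono_def by blast

lemma equiv_belowD: "equiv_below p \<phi> \<psi> \<Longrightarrow> p \<in> elts P \<Longrightarrow> \<phi> p \<longleftrightarrow> \<psi> p"
  unfolding equiv_below_def using refl by blast

end

text \<open>\<open>J\<close> is either the forcing interpretation or its relativization to a transitive set, and
  \<open>D p \<sigma>\<close> says that \<open>\<sigma>\<close> names an element of the domain below \<open>p\<close>. A relativized quantifier is a
  quantified implication, hence a negation, so that it can only be instantiated at a stronger
  condition.\<close>

locale forcing_interp = forcing_notion P r for P :: "'v::zfc" and r +
  fixes J :: "('v, 'v \<Rightarrow> bool) interp" and D :: "'v \<Rightarrow> 'v \<Rightarrow> bool"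
  assumes J_base [simp]: "Mem J = Mem F" "Eq J = Eq F" "Neg J = Neg F" "Conj J = Conj F"
    and D_name: "D p \<sigma> \<Longrightarrow> forcing_name P \<sigma>"
    and D_mono: "D p \<sigma> \<Longrightarrow> q \<preceq> p \<Longrightarrow> D q \<sigma>"
    and D_mem: "D p \<tau> \<Longrightarrow> M p \<sigma> \<tau> \<Longrightarrow> forcing_name P \<sigma> \<Longrightarrow> p \<in> elts P \<Longrightarrow> D p \<sigma>"
    and Forall_elim: "Forall J \<Phi> p \<Longrightarrow> D p \<sigma> \<Longrightarrow> p \<in> elts P \<Longrightarrow> \<exists>q. q \<preceq> p \<and> \<Phi> \<sigma> q"
    and Forall_intro: "(\<And>\<sigma> q. q \<preceq> p \<Longrightarrow> D q \<sigma> \<Longrightarrow> \<Phi> \<sigma> q) \<Longrightarrow> p \<in> elts P \<Longrightarrow> Forall J \<Phi> p"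
    and mono_Forall: "(\<And>\<sigma>. mono (\<Phi> \<sigma>)) \<Longrightarrow> mono (Forall J \<Phi>)"
    and equiv_Forall:
      "(\<And>\<sigma>. equiv_below p (\<Phi> \<sigma>) (\<Psi> \<sigma>)) \<Longrightarrow> equiv_below p (Forall J \<Phi>) (Forall J \<Psi>)"
begin

lemma mono_Neg [intro!, simp]: "mono (Neg J \<phi>)"
  unfolding mono_def using trans by (auto simp del: split_paired_All)

lemma mono_connectives [intro!, simp]:
  "mono (Mem J \<sigma> \<tau>)" "mono (Eq J \<sigma> \<tau>)"
  "mono \<phi> \<Longrightarrow> mono \<psi> \<Longrightarrow> mono (Conj J \<phi> \<psi>)"
  unfolding mono_def using M_mono E_mono by auto

text \<open>Each of these consists of negations under conjunctions or universal quantifiers, and a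
  negation is monotone whatever it negates.\<close>

lemma mono_derived [intro!, simp]:
  "mono (Imp J \<phi> \<psi>)" "mono (Disj J \<phi> \<psi>)" "mono (Iff J \<phi> \<psi>)" "mono (Exists J \<Phi>)"
  "mono (ForallIn J a \<Phi>)" "mono (ExistsIn J a \<Phi>)"
  unfolding Imp_def Disj_def Iff_def Exists_def ForallIn_def ExistsIn_def
  by (intro mono_Forall mono_Neg mono_connectives)+

lemma equiv_rules:
  "E p \<sigma> \<sigma>' \<Longrightarrow> E p \<tau> \<tau>' \<Longrightarrow> equiv_below p (Mem J \<sigma> \<tau>) (Mem J \<sigma>' \<tau>')"
  "E p \<sigma> \<sigma>' \<Longrightarrow> E p \<tau> \<tau>' \<Longrightarrow> equiv_below p (Eq J \<sigma> \<tau>) (Eq J \<sigma>' \<tau>')"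
  "equiv_below p \<phi> \<phi>' \<Longrightarrow> equiv_below p (Neg J \<phi>) (Neg J \<phi>')"
  "equiv_below p \<phi> \<phi>' \<Longrightarrow> equiv_below p \<psi> \<psi>' \<Longrightarrow> equiv_below p (Conj J \<phi> \<psi>) (Conj J \<phi>' \<psi>')"
proof -
  show "equiv_below p (Mem J \<sigma> \<tau>) (Mem J \<sigma>' \<tau>')" if "E p \<sigma> \<sigma>'" "E p \<tau> \<tau>'"
    unfolding equiv_below_def J_base F_simps
    using that M_cong E_mono E_sym by metis
  show "equiv_below p (Eq J \<sigma> \<tau>) (Eq J \<sigma>' \<tau>')" if "E p \<sigma> \<sigma>'" "E p \<tau> \<tau>'"
    unfolding equiv_below_def J_base F_simps
    using that E_trans E_mono E_sym by metis
qed (use trans in \<open>auto simp: equiv_below_def\<close>)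

lemma equiv_derived:
  assumes "equiv_below p \<phi> \<phi>'" "equiv_below p \<psi> \<psi>'"
  shows "equiv_below p (Imp J \<phi> \<psi>) (Imp J \<phi>' \<psi>')" "equiv_below p (Disj J \<phi> \<psi>) (Disj J \<phi>' \<psi>')"
    "equiv_below p (Iff J \<phi> \<psi>) (Iff J \<phi>' \<psi>')"
  unfolding Imp_def Disj_def Iff_def by (intro equiv_rules assms)+

lemma equiv_quantifiers:
  assumes "\<And>\<sigma>. equiv_below p (\<Phi> \<sigma>) (\<Psi> \<sigma>)"
  shows "equiv_below p (Exists J \<Phi>) (Exists J \<Psi>)"
    "E p a b \<Longrightarrow> equiv_below p (ForallIn J a \<Phi>) (ForallIn J b \<Psi>)"
    "E p a b \<Longrightarrow> equiv_below p (ExistsIn J a \<Phi>) (ExistsIn J b \<Psi>)"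
  unfolding Exists_def ForallIn_def ExistsIn_def
  by (intro equiv_Forall equiv_rules equiv_derived assms E_refl; assumption)+

lemmas equiv_intros = equiv_rules equiv_derived equiv_quantifiers equiv_Forall E_refl

lemma equiv_formulas:
  assumes "E p x x'" "E p y y'" "E p z z'"
  shows "equiv_below p (is_subset J x y) (is_subset J x' y')"
    "equiv_below p (is_ordinal J x) (is_ordinal J x')"
    "equiv_below p (is_limit J x) (is_limit J x')"
    "equiv_below p (is_omega J x) (is_omega J x')"
    "equiv_below p (is_upair J x y z) (is_upair J x' y' z')"
    "equiv_below p (is_pair J x y z) (is_pair J x' y' z')"
    "equiv_below p (maps_to J x y z) (maps_to J x' y' z')"
    "equiv_below p (is_countable J x) (is_countable J x')"
  unfolding is_subset_def is_ordinal_def is_limit_def is_omega_def is_transitive_def is_upair_def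
    is_pair_def maps_to_def is_countable_def is_injection_def
  by (intro equiv_intros assms)+

lemma Imp_J: "Imp J \<phi> \<psi> = Imp F \<phi> \<psi>" and Iff_J: "Iff J \<phi> \<psi> = Iff F \<phi> \<psi>"
  unfolding Imp_def Iff_def by simp_all

lemma Exists_elim:
  assumes "Exists J \<Phi> p" "p \<in> elts P"
  obtains q \<sigma> where "q \<preceq> p" "D q \<sigma>" "\<Phi> \<sigma> q"
proof -
  have "\<not> Forall J (\<lambda>\<sigma>. Neg J (\<Phi> \<sigma>)) p" using assms refl by (auto simp: Exists_def)
  then obtain \<sigma> q where q: "q \<preceq> p" "D q \<sigma>" "\<not> Neg J (\<Phi> \<sigma>) q"
    using Forall_intro[where p = p and \<Phi> = "\<lambda>\<sigma>. Neg J (\<Phi> \<sigma>)"] assms(2) by blast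
  then obtain q' where "q' \<preceq> q" "\<Phi> \<sigma> q'" by auto
  then show thesis using that q trans D_mono by blast
qed

lemma ForallIn_elim:
  assumes "ForallIn J a \<Phi> p" "D p \<sigma>" "M p \<sigma> a" "p \<in> elts P"
  obtains q where "q \<preceq> p" "\<Phi> \<sigma> q"
proof -
  obtain q where q: "q \<preceq> p" "Imp F (Mem J \<sigma> a) (\<Phi> \<sigma>) q"
    using Forall_elim assms unfolding ForallIn_def Imp_J by meson
  moreover have "q \<preceq> q" "M q \<sigma> a" using q M_mono[OF assms(3)] refl leqD by blast+
  ultimately obtain q' where "q' \<preceq> q" "\<Phi> \<sigma> q'" by (auto simp: Imp_F)
  then show thesis using that q trans by blast
qed

lemma ForallIn_intro:
  assumes "\<And>\<sigma> q. q \<preceq> p \<Longrightarrow> D q \<sigma> \<Longrightarrow> M q \<sigma> a \<Longrightarrow> \<exists>q'. q' \<preceq> q \<and> \<Phi> \<sigma> q'" "p \<in> elts P"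
  shows "ForallIn J a \<Phi> p"
  unfolding ForallIn_def Imp_J
proof (rule Forall_intro)
  fix \<sigma> q assume q: "q \<preceq> p" "D q \<sigma>"
  show "Imp F (Mem J \<sigma> a) (\<Phi> \<sigma>) q"
    unfolding Imp_F
  proof (intro allI impI)
    fix q' assume "q' \<preceq> q" "Mem J \<sigma> a q'"
    then show "\<exists>q''. q'' \<preceq> q' \<and> \<Phi> \<sigma> q''" using assms(1) trans[OF _ q(1)] D_mono[OF q(2)] by simp
  qed
qed (rule assms)

lemma ExistsIn_elim:
  assumes "ExistsIn J a \<Phi> p" "p \<in> elts P"
  obtains q \<sigma> where "q \<preceq> p" "D q \<sigma>" "M q \<sigma> a" "\<Phi> \<sigma> q"
  using assms unfolding ExistsIn_def by (auto elim!: Exists_elim)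

text \<open>The two bounded quantifiers in transitivity are instantiated at successively stronger
  conditions. Doing so below every \<open>q\<close> stronger than \<open>p\<close> gives density,
  and \<open>M_dense\<close> returns to \<open>p\<close>.\<close>

lemma transitive_elim:
  assumes "is_transitive J w p" "D p w" "M p x w" "M p y x" "forcing_name P x" "forcing_name P y"
    and p: "p \<in> elts P"
  shows "M p y w"
proof (rule M_dense[OF _ p])
  fix q assume q: "q \<preceq> p"
  have "q \<in> elts P" using q leqD by blast
  have "is_transitive J w q"
    using assms(1) q by (auto simp: is_transitive_def intro: monoD)
  moreover have "D q w" "M q x w" "M q y x" using assms q D_mono M_mono by blast+
  moreover then have "D q x" using D_mem assms(5) \<open>q \<in> elts P\<close> by blast
  ultimately obtain q' where q': "q' \<preceq> q" "is_subset J x w q'"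
    using ForallIn_elim[of w _ q x] \<open>q \<in> elts P\<close> unfolding is_transitive_def by metis
  moreover have "M q' y x" "D q' x" "q' \<in> elts P"
    using q' \<open>M q y x\<close> \<open>D q x\<close> M_mono D_mono leqD by blast+
  moreover then have "D q' y" using D_mem assms(6) by blast
  ultimately obtain q'' where "q'' \<preceq> q'" "Mem J y w q''"
    using ForallIn_elim[of x _ q' y] unfolding is_subset_def by metis
  then show "\<exists>q'. q' \<preceq> q \<and> M q' y w" using q' trans by auto
qed

text \<open>The forced version of "an ordinal is zero, a successor or a limit": \<open>y\<close> in
  the second case is the largest element. Which case holds is settled only at a stronger
  condition.\<close>

lemma not_limit_cases:
  assumes lim: "Neg J (is_limit J x) p" and ord: "is_ordinal J x p" and p: "p \<in> elts P"
  obtains (empty) q where "q \<preceq> p" "\<And>\<sigma> q'. q' \<preceq> q \<Longrightarrow> D q' \<sigma> \<Longrightarrow> \<not> M q' \<sigma> x"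
  | (max) q y where "q \<preceq> p" "D q y" "M q y x"
    "\<And>z q'. q' \<preceq> q \<Longrightarrow> D q' z \<Longrightarrow> M q' z x \<Longrightarrow> \<not> M q' y z"
proof (cases "Exists J (\<lambda>y. Mem J y x) p")
  case False
  then obtain q where q: "q \<preceq> p" "Forall J (\<lambda>y. Neg J (Mem J y x)) q"
    unfolding Exists_def J_base F_simps by blast
  have "\<not> M q' \<sigma> x" if q': "q' \<preceq> q" "D q' \<sigma>" for \<sigma> q'
  proof
    assume "M q' \<sigma> x"
    have *: "Forall J (\<lambda>y. Neg J (Mem J y x)) q'"
      by (rule monoD[OF mono_Forall[OF mono_Neg] q(2) q'(1)])
    then obtain q'' where q'': "q'' \<preceq> q'" "Neg J (Mem J \<sigma> x) q''"
      using Forall_elim[OF * q'(2) leqD(1)[OF q'(1)]] by blast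
    moreover have "M q'' \<sigma> x" "q'' \<preceq> q''" using q'' \<open>M q' \<sigma> x\<close> M_mono refl leqD by blast+
    ultimately show False by auto
  qed
  then show thesis using empty q(1) by blast
next
  case True
  have "\<not> ForallIn J x (\<lambda>y. ExistsIn J x (\<lambda>z. Mem J y z)) p"
  proof -
    have "\<not> is_limit J x p" using lim refl[OF p] by simp
    then show ?thesis using True ord by (simp add: is_limit_def)
  qed
  then obtain q y where q: "q \<preceq> p" "D q y" "M q y x"
    "\<And>q'. q' \<preceq> q \<Longrightarrow> \<not> ExistsIn J x (\<lambda>z. Mem J y z) q'"
    using ForallIn_intro[of p x "\<lambda>y. ExistsIn J x (\<lambda>z. Mem J y z)"] p by blast
  have "q \<preceq> q" using q refl leqD by blast
  then have "\<not> ExistsIn J x (\<lambda>z. Mem J y z) q" using q by blast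
  then obtain q1 where q1: "q1 \<preceq> q" "Forall J (\<lambda>z. Neg J (Conj J (Mem J z x) (Mem J y z))) q1"
    unfolding ExistsIn_def Exists_def J_base F_simps by blast
  have "\<not> M q' y z" if q': "q' \<preceq> q1" "D q' z" "M q' z x" for z q'
  proof
    assume "M q' y z"
    have *: "Forall J (\<lambda>z. Neg J (Conj J (Mem J z x) (Mem J y z))) q'"
      by (rule monoD[OF mono_Forall[OF mono_Neg] q1(2) q'(1)])
    then obtain q'' where q'': "q'' \<preceq> q'" "Neg J (Conj J (Mem J z x) (Mem J y z)) q''"
      using Forall_elim[OF * q'(2) leqD(1)[OF q'(1)]] by blast
    moreover have "M q'' y z" "M q'' z x" "q'' \<preceq> q''"
      using q'' q' \<open>M q' y z\<close> M_mono refl leqD by blast+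
    ultimately show False by auto
  qed
  moreover have "q1 \<preceq> p" "D q1 y" "M q1 y x" using q1 q trans D_mono M_mono by blast+
  ultimately show thesis using max by blast
qed

text \<open>Forcing adds no natural numbers. By induction on names, an element of \<open>w\<close>
  is an ordinal and not a limit. It is therefore empty, hence zero, or it has a largest element; the
  latter equals a numeral \<open>n\<close>, and then the element itself equals
  \<open>n + 1\<close>.\<close>

lemma elements_of_omega:
  assumes w: "is_omega J w p" "D p w" and p: "p \<in> elts P"
    and x: "forcing_name P x" "q \<preceq> p" "M q x w"
  shows "\<exists>q' n. q' \<preceq> q \<and> E q' x (chk (num n))"
  using x
proof (induction x arbitrary: q rule: forcing_name.induct)
  case (1 x)
  have name_x: "forcing_name P x" by (rule forcing_name.intros) (use 1(1) in blast)
  have IH: "\<exists>q' n. q' \<preceq> q \<and> E q' \<rho> (chk (num n))"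
    if "vpair \<rho> t \<in> elts x" "q \<preceq> p" "M q \<rho> w" for \<rho> t q
    using 1(1)[OF that(1)] that by auto
  have name_dom_x: "forcing_name P \<rho>" if "vpair \<rho> t \<in> elts x" for \<rho> t
    using name_dom[OF name_x that] .
  note q = \<open>q \<preceq> p\<close>
  have qP: "q \<in> elts P" using q leqD by blast
  have w_tr: "is_transitive J w p" and w_ord: "ForallIn J w (is_transitive J) p"
    and w_lim: "ForallIn J w (\<lambda>y. Neg J (is_limit J y)) p"
    using w by (auto simp: is_omega_def is_limit_def is_ordinal_def)
  have up: "M q' y w" if "q' \<preceq> p" "M q' z w" "M q' y z" "forcing_name P z" "forcing_name P y" for q' y z
  proof (rule transitive_elim[OF _ D_mono[OF w(2) that(1)] that(2-5) leqD(1)[OF that(1)]])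
    show "is_transitive J w q'"
      by (rule monoD[where p = p]) (use w_tr that in \<open>simp_all add: is_transitive_def\<close>)
  qed
  have Dq: "D q' w" if "q' \<preceq> p" for q' using D_mono w that by blast
  have Dw: "D q' y" if "q' \<preceq> p" "M q' y w" "forcing_name P y" for q' y
    using D_mem[OF Dq[OF that(1)]] that leqD by blast
  have "ForallIn J w (\<lambda>y. Neg J (is_limit J y)) q" using w_lim q monoD by blast
  then obtain q1 where q1: "q1 \<preceq> q" "Neg J (is_limit J x) q1"
    using ForallIn_elim[of w _ q x] Dw[OF q] 1 qP name_x by metis
  have q1p: "q1 \<preceq> p" and Mq1: "M q1 x w" using q1 q trans 1 M_mono by blast+
  have "ForallIn J w (is_transitive J) q1" using w_ord q1p monoD by blast
  then obtain q2 where q2: "q2 \<preceq> q1" "is_transitive J x q2"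
    using ForallIn_elim[of w _ q1 x] Dw[OF q1p Mq1 name_x] Mq1 leqD q1 by metis
  have q2p: "q2 \<preceq> p" and Mq2: "M q2 x w" and q2P: "q2 \<in> elts P"
    using q1 q1p q2 q trans Mq1 M_mono leqD by blast+
  have x_ord: "is_ordinal J x q2"
    unfolding is_ordinal_def J_base F_simps
  proof (intro conjI ForallIn_intro q2 q2P)
    fix \<sigma> q' assume *: "q' \<preceq> q2" "D q' \<sigma>" "M q' \<sigma> x"
    then have "q' \<preceq> p" "M q' x w" "q' \<in> elts P" using q2p trans Mq2 M_mono leqD by blast+
    then have "M q' \<sigma> w" using up * name_x D_name by blast
    moreover have "ForallIn J w (is_transitive J) q'" using w_ord \<open>q' \<preceq> p\<close> monoD by blast
    ultimately show "\<exists>q''. q'' \<preceq> q' \<and> is_transitive J \<sigma> q''"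
      using ForallIn_elim[of w _ q' \<sigma>] * \<open>q' \<in> elts P\<close> by metis
  qed
  have "Neg J (is_limit J x) q2" by (rule monoD[OF mono_Neg q1(2) q2(1)])
  from this x_ord q2P show ?case
  proof (cases rule: not_limit_cases)
    case (empty q3)
    have q3: "q3 \<preceq> p" using empty q2p trans by blast
    have "E q3 x (chk (num 0))"
    proof (rule E_ext)
      fix \<rho> t q' assume *: "vpair \<rho> t \<in> elts x" "q' \<preceq> q3" "q' \<preceq> t"
      then have "M q' \<rho> x" by (rule_tac M_intro)
      moreover have "M q' x w" "q' \<preceq> p" using * empty Mq2 M_mono q3 trans by blast+
      ultimately have "D q' \<rho>" using up Dw name_x name_dom_x * by blast
      then show "M q' \<rho> (chk (num 0))" using empty * \<open>M q' \<rho> x\<close> by blast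
    qed (auto simp: elts_check_name elts_num)
    then show ?thesis using empty q1 q2 trans by blast
  next
    case (max q3 y)
    have q3: "q3 \<preceq> p" "M q3 x w" "q3 \<in> elts P" using max q2p Mq2 trans M_mono leqD by blast+
    \<comment> \<open>The induction hypothesis covers only names occurring in \<open>x\<close>, so
      \<open>y\<close> is replaced by such a name, forced equal to it.\<close>
    obtain q4 \<rho> t where q4: "q4 \<preceq> q3" "vpair \<rho> t \<in> elts x" "q4 \<preceq> t" "E q4 y \<rho>"
      using M_elim[OF max(3) q3(3)] .
    have "q4 \<preceq> p" "M q4 x w" "q4 \<in> elts P" using q4 q3 trans M_mono leqD by blast+
    moreover have "M q4 \<rho> x" using M_intro q4 by blast
    ultimately have "M q4 \<rho> w" using up name_x name_dom_x q4 by blast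
    then obtain q5 n where q5: "q5 \<preceq> q4" "E q5 \<rho> (chk (num n))"
      using IH q4 \<open>q4 \<preceq> p\<close> by blast
    have En: "E q5 y (chk (num n))" using E_trans E_mono q4 q5 by blast
    have q5': "q5 \<preceq> p" "q5 \<preceq> q3" using q5 q4 q3 trans by blast+
    have x_tr: "is_transitive J x q'" if "q' \<preceq> q5" for q'
    proof (rule monoD[where p = q2 and \<phi> = "is_transitive J x", OF _ q2(2)])
      show "q' \<preceq> q2" using that q5' max trans by blast
      show "mono (is_transitive J x)" by (simp add: is_transitive_def)
    qed
    have "E q5 x (chk (num (Suc n)))"
    proof (rule E_ext)
      fix \<rho>' t' q' assume *: "vpair \<rho>' t' \<in> elts x" "q' \<preceq> q5" "q' \<preceq> t'"
      have M: "M q' \<rho>' x" using * by (rule_tac M_intro)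
      have q': "q' \<preceq> p" "q' \<preceq> q3" "M q' x w" "q' \<in> elts P"
        using * q5' q3 trans M_mono leqD by blast+
      have Mw: "M q' \<rho>' w" using up M q' name_x name_dom_x * by blast
      show "M q' \<rho>' (chk (num (Suc n)))"
      proof (rule M_dense[OF _ q'(4)])
        fix q6 assume q6: "q6 \<preceq> q'"
        have "M q6 \<rho>' w" "q6 \<preceq> p" using q6 q' Mw M_mono trans by blast+
        then obtain q7 m where q7: "q7 \<preceq> q6" "E q7 \<rho>' (chk (num m))" using IH * by blast
        have 7: "q7 \<preceq> q'" "q7 \<preceq> q3" "q7 \<preceq> p" "q7 \<preceq> q5" "q7 \<in> elts P"
          using q7 q6 q' * trans leqD by blast+
        \<comment> \<open>By maximality \<open>y\<close>, which equals the numeral \<open>n\<close>,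
          is not an element of \<open>\<rho>'\<close>, which equals the numeral \<open>m\<close>. So
          \<open>n < m\<close> fails.\<close>
        have "\<not> M q7 y \<rho>'"
          using max(4)[of q7 \<rho>'] 7 M M_mono Dw[of q7 \<rho>'] Mw name_dom_x * by blast
        moreover have "E q7 (chk (num n)) y" using En 7 E_mono E_sym by blast
        ultimately have "\<not> M q7 (chk (num n)) (chk (num m))"
          using M_cong E_sym q7(2) by blast
        then have "m < Suc n" using M_check_iff 7 by auto
        then have "M q7 (chk (num m)) (chk (num (Suc n)))" using M_check_iff 7 by simp
        then have "M q7 \<rho>' (chk (num (Suc n)))"
          using M_cong[OF _ E_sym[OF q7(2)] E_refl] by blast
        then show "\<exists>q'. q' \<preceq> q6 \<and> M q' \<rho>' (chk (num (Suc n)))" using q7 by blast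
      qed
    next
      fix \<rho>' t' q' assume *: "vpair \<rho>' t' \<in> elts (chk (num (Suc n)))" "q' \<preceq> q5" "q' \<preceq> t'"
      then obtain m where m: "\<rho>' = chk (num m)" "m \<le> n"
        by (auto simp: elts_check_name elts_num less_Suc_eq_le)
      have q': "q' \<preceq> p" "q' \<in> elts P" "q' \<preceq> q3" using * q5' trans leqD by blast+
      have "M q' y x" "E q' y (chk (num n))" using q' * En max M_mono E_mono by blast+
      then have n: "M q' (chk (num n)) x" using M_cong[OF _ _ E_refl] by blast
      show "M q' \<rho>' x"
      proof (cases "m = n")
        case False
        then have "M q' (chk (num m)) (chk (num n))" using m q' M_check_iff by simp
        moreover have "D q' x" using Dw q' q3 M_mono name_x by blast
        ultimately show ?thesis
          unfolding m using transitive_elim[OF x_tr] * n q' name_check by blast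
      qed (use n m in simp)
    qed
    moreover have "q5 \<preceq> q" using trans[OF q5'(2) trans[OF max(1) trans[OF q2(1) q1(1)]]] .
    ultimately show ?thesis by blast
  qed
qed

text \<open>The countable chain condition, applied to conditions deciding the values of a name for an
  injection: conditions giving distinct elements the same value are incompatible.\<close>

lemma countable_if_forced_countable:
  assumes ccc: "\<And>A. A \<subseteq> elts P \<Longrightarrow> (\<And>p q s. p \<in> A \<Longrightarrow> q \<in> A \<Longrightarrow> s \<preceq> p \<Longrightarrow> s \<preceq> q \<Longrightarrow> p = q) \<Longrightarrow> countable A"
    and count: "is_countable J (chk a) p" and a: "D p (chk a)" and p: "p \<in> elts P"
  shows "countable (elts a)"
proof -
  obtain p1 w where p1: "p1 \<preceq> p" "D p1 w" "is_omega J w p1"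
    "Exists J (\<lambda>f. is_injection J f (chk a) w) p1"
    using Exists_elim[OF count[unfolded is_countable_def J_base F_simps] p] by metis
  have p1P: "p1 \<in> elts P" using p1 leqD by blast
  obtain p2 f where p2: "p2 \<preceq> p1" "is_injection J f (chk a) w p2"
    using Exists_elim[OF p1(4) p1P] by metis
  have p2P: "p2 \<in> elts P" using p2 leqD by blast
  have Da: "D q (chk a)" and Dw: "D q w" if "q \<preceq> p2" for q
    using that p1 p2 a trans D_mono by blast+
  have Dx: "D q (chk x)" if "q \<preceq> p2" "x \<in> elts a" for x q
    using D_mem[OF Da] M_check_intro that leqD name_check by blast
  have mono_maps: "mono (maps_to J f (chk x) z)" for x z unfolding maps_to_def by simp
  have equiv_maps: "E q y y' \<Longrightarrow> q \<in> elts P \<Longrightarrow> maps_to J f x y q \<longleftrightarrow> maps_to J f x y' q" for x y y' q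
    using equiv_formulas(7)[OF E_refl E_refl] equiv_belowD by blast
  \<comment> \<open>Each of the three bounded quantifiers costs a stronger condition. The conclusion
    is an equality in the universe, so nothing is lost by strengthening.\<close>
  have inj: "x = x'"
    if *: "x \<in> elts a" "x' \<in> elts a" "q \<preceq> p2" "M q y w" "forcing_name P y"
      "maps_to J f (chk x) y q" "maps_to J f (chk x') y q" for x x' y q
  proof -
    let ?I = "\<lambda>x x' y. Imp J (Conj J (maps_to J f x y) (maps_to J f x' y)) (Eq J x x')"
    have qP: "q \<in> elts P" using * leqD by blast
    have C2: "\<psi> s" if "Conj J \<phi> \<psi> s" for \<phi> \<psi> s using that by simp
    have 0: "ForallIn J (chk a) (\<lambda>x. ForallIn J (chk a) (\<lambda>x'. ForallIn J w (\<lambda>y. ?I x x' y))) q"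
      using monoD[OF mono_derived(5) C2[OF C2[OF p2(2)[unfolded is_injection_def]]] *(3)] .
    obtain q1 where q1: "q1 \<preceq> q" "ForallIn J (chk a) (\<lambda>x'. ForallIn J w (\<lambda>y. ?I (chk x) x' y)) q1"
      by (rule ForallIn_elim[OF 0 Dx[OF *(3,1)] M_check_intro[OF *(1) qP] qP])
    have q1': "q1 \<preceq> p2" "q1 \<in> elts P" using q1 * trans leqD by blast+
    obtain q2 where q2: "q2 \<preceq> q1" "ForallIn J w (\<lambda>y. ?I (chk x) (chk x') y) q2"
      by (rule ForallIn_elim[OF q1(2) Dx[OF q1'(1) *(2)] M_check_intro[OF *(2) q1'(2)] q1'(2)])
    have q2': "q2 \<preceq> p2" "q2 \<in> elts P" "q2 \<preceq> q" using q1 q2 q1' * trans leqD by blast+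
    have y: "M q2 y w" "D q2 y" using * q2' M_mono D_mem Dw by blast+
    obtain q3 where q3: "q3 \<preceq> q2" "?I (chk x) (chk x') y q3"
      by (rule ForallIn_elim[OF q2(2) y(2,1) q2'(2)])
    have q3': "q3 \<preceq> q3" "q3 \<preceq> q" using q3 q2' trans refl leqD by blast+
    then have "maps_to J f (chk x) y q3" "maps_to J f (chk x') y q3"
      using * monoD[OF mono_maps] by blast+
    then obtain q4 where "q4 \<preceq> q3" "E q4 (chk x) (chk x')"
      using q3(2) q3' unfolding Imp_J Imp_F J_base F_simps by blast
    then show ?thesis using E_check_iff leqD by blast
  qed
  \<comment> \<open>The value \<open>y\<close> is merely a name. \<open>elements_of_omega\<close>
    replaces it by a true natural number, by which \<open>a\<close> can be partitioned.\<close>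
  have "\<exists>q n. q \<preceq> p2 \<and> M q (chk (num n)) w \<and> maps_to J f (chk x) (chk (num n)) q"
    if x: "x \<in> elts a" for x
  proof -
    have 0: "ForallIn J (chk a) (\<lambda>x. ExistsIn J w (\<lambda>y. ForallIn J w (\<lambda>y'.
        Iff J (maps_to J f x y') (Eq J y' y)))) p2"
      using p2(2) by (simp add: is_injection_def)
    obtain q1 where q1: "q1 \<preceq> p2"
      "ExistsIn J w (\<lambda>y. ForallIn J w (\<lambda>y'. Iff J (maps_to J f (chk x) y') (Eq J y' y))) q1"
      by (rule ForallIn_elim[OF 0 Dx[OF refl[OF p2P] x] M_check_intro[OF x p2P] p2P])
    obtain q2 y where q2: "q2 \<preceq> q1" "D q2 y" "M q2 y w"
      "ForallIn J w (\<lambda>y'. Iff J (maps_to J f (chk x) y') (Eq J y' y)) q2"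
      by (rule ExistsIn_elim[OF q1(2) leqD(1)[OF q1(1)]])
    obtain q3 where q3: "q3 \<preceq> q2" "Iff J (maps_to J f (chk x) y) (Eq J y y) q3"
      by (rule ForallIn_elim[OF q2(4,2,3) leqD(1)[OF q2(1)]])
    then have "q3 \<preceq> q3" "Eq J y y q3" using refl leqD by (auto simp: E_refl)
    then obtain q4 where q4: "q4 \<preceq> q3" "maps_to J f (chk x) y q4"
      using q3(2) unfolding Iff_J Iff_F by blast
    have "q4 \<preceq> q2" using trans[OF q4(1) q3(1)] .
    moreover from this have "q4 \<preceq> p2" by (rule trans[OF _ trans[OF q2(1) q1(1)]])
    ultimately have q4': "q4 \<preceq> p1" "M q4 y w" "q4 \<preceq> p2"
      using trans[OF _ p2(1)] M_mono[OF q2(3)] by simp_all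
    obtain q5 n where q5: "q5 \<preceq> q4" "E q5 y (chk (num n))"
      using elements_of_omega[OF p1(3,2) p1P D_name[OF q2(2)] q4'(1,2)] by blast
    have "maps_to J f (chk x) y q5" using q4 q5 monoD[OF mono_maps] by blast
    then have "maps_to J f (chk x) (chk (num n)) q5" using equiv_maps q5 leqD by blast
    moreover have "M q5 (chk (num n)) w"
      using M_cong[OF M_mono[OF q4'(2) q5(1)] q5(2) E_refl] .
    ultimately show ?thesis using q4' q5 trans by blast
  qed
  then obtain Q n where Q: "\<And>x. x \<in> elts a \<Longrightarrow> Q x \<preceq> p2 \<and> M (Q x) (chk (num (n x))) w \<and>
      maps_to J f (chk x) (chk (num (n x))) (Q x)"
    by metis
  have "countable {x \<in> elts a. n x = k}" (is "countable ?A") for k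
  proof -
    have same: "x = x'" if "x \<in> ?A" "x' \<in> ?A" "s \<preceq> Q x" "s \<preceq> Q x'" for x x' s
    proof (rule inj[where q = s and y = "chk (num k)"])
      have x: "x \<in> elts a" "n x = k" and x': "x' \<in> elts a" "n x' = k" using that by auto
      show "maps_to J f (chk x) (chk (num k)) s"
        using monoD[OF mono_maps, of x "chk (num k)" "Q x" s] Q[OF x(1)] x that by simp
      show "maps_to J f (chk x') (chk (num k)) s"
        using monoD[OF mono_maps, of x' "chk (num k)" "Q x'" s] Q[OF x'(1)] x' that by simp
      show "s \<preceq> p2" using trans[OF that(3)] Q[OF x(1)] by blast
      show "M s (chk (num k)) w" using M_mono[OF _ that(3)] Q[OF x(1)] x by auto
    qed (use that in auto)
    have "countable (Q ` ?A)"
    proof (rule ccc)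
      show "Q ` ?A \<subseteq> elts P" using Q leqD by blast
    qed (use same in blast)
    moreover have "inj_on Q ?A"
      using same Q refl leqD by (intro inj_onI) (metis (no_types, lifting) mem_Collect_eq)
    ultimately show ?thesis using countable_image_inj_on by blast
  qed
  then have "countable (\<Union>k. {x \<in> elts a. n x = k})" by simp
  moreover have "(\<Union>k. {x \<in> elts a. n x = k}) = elts a" by auto
  ultimately show ?thesis by simp
qed

end

section \<open>The two instances of \<open>forcing_interp\<close>, and sets defined by comprehension
  in the extension\<close>

context forcing_notion begin

lemma forcing_interp_F: "forcing_interp P r F (\<lambda>p \<sigma>. forcing_name P \<sigma>)"
proof (unfold_locales, goal_cases)
  case (8 \<Phi> p \<sigma>)
  then show ?case using refl by auto
next
  case (9 p \<Phi>)
  then show ?case using refl by auto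
next
  case (10 \<Phi>)
  then show ?case by (auto simp: mono_def)
next
  case (11 p \<Phi> \<Psi>)
  then show ?case by (auto simp: equiv_below_def)
qed auto

interpretation F: forcing_interp P r F "\<lambda>p \<sigma>. forcing_name P \<sigma>"
  by (rule forcing_interp_F)

declare F.J_base [simp del]

lemmas equiv_intros_F = F.equiv_intros
  and equiv_formulas_F = F.equiv_formulas
  and mono_F = F.mono_connectives F.mono_derived

lemma M_check_subset:
  assumes "M p \<sigma> (chk x)" "elts x \<subseteq> elts y" "p \<in> elts P"
  shows "M p \<sigma> (chk y)"
proof (rule M_dense[OF _ assms(3)])
  fix q assume q: "q \<preceq> p"
  then obtain q' z where q': "q' \<preceq> q" "z \<in> elts x" "E q' \<sigma> (chk z)"
    using M_check_elim[OF M_mono[OF assms(1) q]] leqD by blast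
  then have "M q' (chk z) (chk y)" using M_check_intro assms(2) leqD by blast
  then have "M q' \<sigma> (chk y)" using M_cong[OF _ E_sym[OF q'(3)] E_refl] by blast
  then show "\<exists>q'. q' \<preceq> q \<and> M q' \<sigma> (chk y)" using q' by blast
qed

text \<open>Transitivity of \<open>N\<close> is used for \<open>D_mem\<close>: a name for an element
  of an element of \<open>N\<close> is densely a name for an element of some \<open>y\<close> in
  \<open>N\<close>, and \<open>y\<close> is a subset of \<open>N\<close>.\<close>

lemma forcing_interp_relativize:
  assumes "Transset N"
  shows "forcing_interp P r (relativize F (chk N)) (\<lambda>p \<sigma>. forcing_name P \<sigma> \<and> M p \<sigma> (chk N))"
proof -
  have [simp]: "Forall (relativize F (chk N)) = ForallIn F (chk N)"
    by (simp add: relativize_def)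
  show ?thesis
  proof (unfold_locales, goal_cases)
    case (6 p \<sigma> q)
    then show ?case using M_mono by blast
  next
    case (7 p \<tau> \<sigma>)
    have "M p \<sigma> (chk N)"
    proof (rule M_dense[OF _ 7(4)])
      fix q assume q: "q \<preceq> p"
      then have "M q \<tau> (chk N)" "q \<in> elts P" using 7 M_mono leqD by blast+
      then obtain q' y where q': "q' \<preceq> q" "y \<in> elts N" "E q' \<tau> (chk y)"
        using M_check_elim by blast
      then have "M q' \<sigma> (chk y)"
        using M_cong[OF M_mono[OF 7(2) trans[OF q'(1) q]] E_refl] by blast
      then have "M q' \<sigma> (chk N)"
        using M_check_subset assms q' leqD unfolding Transset_def by blast
      then show "\<exists>q'. q' \<preceq> q \<and> M q' \<sigma> (chk N)" using q' by blast
    qed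
    then show ?case using 7 by blast
  next
    case (8 \<Phi> p \<sigma>)
    then show ?case using refl by (auto simp: ForallIn_F)
  next
    case (9 p \<Phi>)
    then show ?case using refl leqD unfolding \<open>Forall _ = _\<close> ForallIn_F by blast
  next
    case (10 \<Phi>)
    then show ?case using trans unfolding \<open>Forall _ = _\<close> mono_def ForallIn_F by blast
  next
    case (11 p \<Phi> \<Psi>)
    then show ?case using trans unfolding \<open>Forall _ = _\<close> equiv_below_def ForallIn_F by metis
  qed (simp_all add: relativize_def)
qed

text \<open>The common core of pairs, intersections, unions and the set of ordinals of
  \<open>N\<close>. If \<open>\<Psi>\<close> is forced for the check names of elements of
  \<open>k\<close>, and densely for nothing else, then defining a set by \<open>\<Psi>\<close> in
  the extension yields the set \<open>k\<close> of the universe.\<close>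

lemma comprehension_iff:
  assumes name: "forcing_name P \<tau>" and p: "p \<in> elts P"
    and elem: "\<And>u q. forcing_name P u \<Longrightarrow> q \<preceq> p \<Longrightarrow> \<Psi> u q \<Longrightarrow>
      \<exists>q' w. q' \<preceq> q \<and> w \<in> elts k \<and> E q' u (chk w)"
    and holds: "\<And>w q. w \<in> elts k \<Longrightarrow> q \<preceq> p \<Longrightarrow> \<Psi> (chk w) q"
    and cong: "\<And>u u' q. E q u u' \<Longrightarrow> equiv_below q (\<Psi> u) (\<Psi> u')"
  shows "Forall F (\<lambda>u. Iff F (Mem F u \<tau>) (\<Psi> u)) p \<longleftrightarrow> E p \<tau> (chk k)"
proof
  assume all: "Forall F (\<lambda>u. Iff F (Mem F u \<tau>) (\<Psi> u)) p"
  have 1: "\<exists>q'. q' \<preceq> q \<and> \<Psi> u q'" if "forcing_name P u" "q \<preceq> p" "M q u \<tau>" for u q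
    using all that unfolding F_simps Iff_F by blast
  have 2: "\<exists>q'. q' \<preceq> q \<and> M q' u \<tau>" if "forcing_name P u" "q \<preceq> p" "\<Psi> u q" for u q
    using all that unfolding F_simps Iff_F by blast
  show "E p \<tau> (chk k)"
  proof (rule E_ext)
    fix \<sigma> s q assume *: "vpair \<sigma> s \<in> elts \<tau>" "q \<preceq> p" "q \<preceq> s"
    have M: "M q \<sigma> \<tau>" using M_intro * by blast
    have \<sigma>: "forcing_name P \<sigma>" using name_dom[OF name *(1)] .
    show "M q \<sigma> (chk k)"
    proof (rule M_dense)
      fix q1 assume q1: "q1 \<preceq> q"
      then obtain q2 where q2: "q2 \<preceq> q1" "\<Psi> \<sigma> q2"
        using 1[OF \<sigma> trans[OF q1 *(2)] M_mono[OF M q1]] by blast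
      then obtain q3 w where q3: "q3 \<preceq> q2" "w \<in> elts k" "E q3 \<sigma> (chk w)"
        using elem[OF \<sigma> trans[OF q2(1) trans[OF q1 *(2)]]] by blast
      have "M q3 \<sigma> (chk k)"
        using M_cong[OF M_check_intro[OF q3(2)] E_sym[OF q3(3)] E_refl] leqD(1)[OF q3(1)] by blast
      then show "\<exists>q'. q' \<preceq> q1 \<and> M q' \<sigma> (chk k)" using trans[OF q3(1) q2(1)] by blast
    qed (rule leqD[OF *(2)])
  next
    fix \<sigma> s q assume *: "vpair \<sigma> s \<in> elts (chk k)" "q \<preceq> p" "q \<preceq> s"
    then obtain w where w: "\<sigma> = chk w" "w \<in> elts k" by (auto simp: elts_check_name)
    show "M q \<sigma> \<tau>"
    proof (rule M_dense)
      fix q1 assume "q1 \<preceq> q"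
      then have "q1 \<preceq> p" using * trans by blast
      then show "\<exists>q'. q' \<preceq> q1 \<and> M q' \<sigma> \<tau>" unfolding w using 2 holds w name_check by blast
    qed (rule leqD[OF *(2)])
  qed
next
  assume eq: "E p \<tau> (chk k)"
  show "Forall F (\<lambda>u. Iff F (Mem F u \<tau>) (\<Psi> u)) p"
    unfolding F_simps Iff_F
  proof (intro allI impI conjI)
    fix u q assume *: "forcing_name P u" "q \<preceq> p" "M q u \<tau>"
    have "M q u (chk k)" using M_cong[OF *(3) E_refl E_mono[OF eq *(2)]] .
    then obtain q1 w where q1: "q1 \<preceq> q" "w \<in> elts k" "E q1 u (chk w)"
      using M_check_elim leqD(1)[OF *(2)] by blast
    have "\<Psi> (chk w) q1" using holds[OF q1(2) trans[OF q1(1) *(2)]] .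
    then have "\<Psi> u q1" using equiv_belowD[OF cong[OF q1(3)] leqD(1)[OF q1(1)]] by blast
    then show "\<exists>q'. q' \<preceq> q \<and> \<Psi> u q'" using q1 by blast
  next
    fix u q assume *: "forcing_name P u" "q \<preceq> p" "\<Psi> u q"
    then obtain q1 w where q1: "q1 \<preceq> q" "w \<in> elts k" "E q1 u (chk w)" using elem by blast
    have "E q1 (chk k) \<tau>" using E_sym[OF E_mono[OF eq trans[OF q1(1) *(2)]]] .
    then have "M q1 u \<tau>"
      using M_cong[OF M_check_intro[OF q1(2) leqD(1)[OF q1(1)]] E_sym[OF q1(3)]] by blast
    then show "\<exists>q'. q' \<preceq> q \<and> M q' u \<tau>" using q1 by blast
  qed
qed

lemma Disj_F_intro: "(\<And>q. q \<preceq> p \<Longrightarrow> \<phi> q \<or> \<psi> q) \<Longrightarrow> Disj F \<phi> \<psi> p"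
  unfolding Disj_F using refl leqD by blast

lemma is_upair_F:
  assumes "forcing_name P \<tau>" "p \<in> elts P"
  shows "is_upair F \<tau> (chk x) (chk y) p \<longleftrightarrow> E p \<tau> (chk (set_of {x, y}))"
  unfolding is_upair_def
proof (rule comprehension_iff[OF assms])
  fix u q assume *: "forcing_name P u" "q \<preceq> p" "Disj F (Eq F u (chk x)) (Eq F u (chk y)) q"
  then obtain q' where "q' \<preceq> q" "E q' u (chk x) \<or> E q' u (chk y)"
    using refl leqD unfolding Disj_F F_simps by blast
  then show "\<exists>q' w. q' \<preceq> q \<and> w \<in> elts (set_of {x, y}) \<and> E q' u (chk w)" by auto
next
  fix w q assume "w \<in> elts (set_of {x, y})" "q \<preceq> p"
  then show "Disj F (Eq F (chk w) (chk x)) (Eq F (chk w) (chk y)) q"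
    by (intro Disj_F_intro) (auto simp: E_refl)
qed (intro F.equiv_intros; assumption)

lemma is_pair_F:
  assumes "forcing_name P \<tau>" "p \<in> elts P"
  shows "is_pair F \<tau> (chk x) (chk y) p \<longleftrightarrow> E p \<tau> (chk (vpair x y))"
  unfolding is_pair_def
proof (rule comprehension_iff[OF assms])
  fix u q
  assume *: "forcing_name P u" "q \<preceq> p"
    "Disj F (is_upair F u (chk x) (chk x)) (is_upair F u (chk x) (chk y)) q"
  then obtain q' where "q' \<preceq> q" "is_upair F u (chk x) (chk x) q' \<or> is_upair F u (chk x) (chk y) q'"
    using refl leqD unfolding Disj_F by blast
  then show "\<exists>q' w. q' \<preceq> q \<and> w \<in> elts (vpair x y) \<and> E q' u (chk w)"
    using is_upair_F[OF *(1)] leqD unfolding vpair_def by fastforce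
next
  fix w q assume "w \<in> elts (vpair x y)" "q \<preceq> p"
  then show "Disj F (is_upair F (chk w) (chk x) (chk x)) (is_upair F (chk w) (chk x) (chk y)) q"
    by (intro Disj_F_intro) (auto simp: vpair_def is_upair_F E_refl dest: leqD)
qed (intro F.equiv_intros F.equiv_formulas; assumption)

section \<open>Absoluteness: at check names all conditions give the verdict of the universe\<close>

definition decides :: "('v \<Rightarrow> bool) \<Rightarrow> bool \<Rightarrow> bool" where
  "decides \<phi> b \<longleftrightarrow> (\<forall>p\<in>elts P. \<phi> p = b)"

lemma decidesD: "decides \<phi> b \<Longrightarrow> p \<in> elts P \<Longrightarrow> \<phi> p = b"
  unfolding decides_def by blast

lemma decides_rules:
  "decides (Mem F (chk x) (chk y)) (Mem universe x y)"
  "decides (Eq F (chk x) (chk y)) (Eq universe x y)"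
  "decides \<phi> b \<Longrightarrow> decides \<psi> c \<Longrightarrow> decides (Conj F \<phi> \<psi>) (Conj universe b c)"
  unfolding decides_def by (simp_all add: M_check_iff E_check_iff)

lemma decides_Neg: "decides \<phi> b \<Longrightarrow> decides (Neg F \<phi>) (Neg universe b)"
  unfolding decides_def F_simps universe_simps using refl leqD by blast

lemmas decides_connectives = decides_rules decides_Neg

lemma decides_derived:
  "decides \<phi> b \<Longrightarrow> decides \<psi> c \<Longrightarrow> decides (Imp F \<phi> \<psi>) (Imp universe b c)"
  "decides \<phi> b \<Longrightarrow> decides \<psi> c \<Longrightarrow> decides (Iff F \<phi> \<psi>) (Iff universe b c)"
  unfolding Imp_def Iff_def by (intro decides_connectives; assumption)+

lemma decides_ForallIn:
  assumes "\<And>x. x \<in> elts a \<Longrightarrow> decides (\<Phi> (chk x)) (\<phi> x)"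
    and cong: "\<And>p \<sigma> \<sigma>'. E p \<sigma> \<sigma>' \<Longrightarrow> equiv_below p (\<Phi> \<sigma>) (\<Phi> \<sigma>')"
  shows "decides (ForallIn F (chk a) \<Phi>) (ForallIn universe a \<phi>)"
  unfolding decides_def
proof
  fix p assume p: "p \<in> elts P"
  show "ForallIn F (chk a) \<Phi> p = ForallIn universe a \<phi>"
  proof
    assume all: "ForallIn F (chk a) \<Phi> p"
    have "\<phi> x" if x: "x \<in> elts a" for x
    proof -
      obtain q where "q \<preceq> p" "\<Phi> (chk x) q"
        using all M_check_intro[OF x p] p refl name_check unfolding ForallIn_F by blast
      then show ?thesis using assms(1)[OF x] decidesD leqD by blast
    qed
    then show "ForallIn universe a \<phi>" by simp
  next
    assume all: "ForallIn universe a \<phi>"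
    show "ForallIn F (chk a) \<Phi> p"
      unfolding ForallIn_F
    proof (intro allI impI)
      fix \<sigma> q assume *: "forcing_name P \<sigma>" "q \<preceq> p" "M q \<sigma> (chk a)"
      then obtain q' x where q': "q' \<preceq> q" "x \<in> elts a" "E q' \<sigma> (chk x)"
        using M_check_elim leqD by blast
      have P: "q' \<in> elts P" using q' leqD by blast
      have "\<phi> x" using all q' by simp
      then have "\<Phi> (chk x) q'" using assms(1) q' decidesD P by blast
      then have "\<Phi> \<sigma> q'" using equiv_belowD[OF cong[OF q'(3)] P] by blast
      then show "\<exists>q'. q' \<preceq> q \<and> \<Phi> \<sigma> q'" using q' by blast
    qed
  qed
qed

text \<open>Monotonicity enters because the witnessing name is identified with a check name only at
  a stronger condition, to which \<open>\<Phi>\<close> has to be carried.\<close>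

lemma decides_ExistsIn:
  assumes "\<And>x. x \<in> elts a \<Longrightarrow> decides (\<Phi> (chk x)) (\<phi> x)"
    and cong: "\<And>p \<sigma> \<sigma>'. E p \<sigma> \<sigma>' \<Longrightarrow> equiv_below p (\<Phi> \<sigma>) (\<Phi> \<sigma>')"
    and mono: "\<And>\<sigma>. mono (\<Phi> \<sigma>)"
  shows "decides (ExistsIn F (chk a) \<Phi>) (ExistsIn universe a \<phi>)"
  unfolding decides_def
proof
  fix p assume p: "p \<in> elts P"
  show "ExistsIn F (chk a) \<Phi> p = ExistsIn universe a \<phi>"
  proof
    assume "ExistsIn F (chk a) \<Phi> p"
    then obtain q \<sigma> where q: "q \<preceq> p" "M q \<sigma> (chk a)" "\<Phi> \<sigma> q"
      using refl[OF p] unfolding ExistsIn_F by blast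
    then obtain q' x where q': "q' \<preceq> q" "x \<in> elts a" "E q' \<sigma> (chk x)"
      using M_check_elim leqD by blast
    have "\<Phi> \<sigma> q'" using monoD[OF mono] q q' by blast
    then have "\<Phi> (chk x) q'" using equiv_belowD[OF cong[OF q'(3)]] leqD(1)[OF q'(1)] by blast
    then have "\<phi> x" using decidesD[OF assms(1)] q' leqD by blast
    then show "ExistsIn universe a \<phi>" using q' by auto
  next
    assume "ExistsIn universe a \<phi>"
    then obtain x where x: "x \<in> elts a" "\<phi> x" by auto
    then have "\<Phi> (chk x) q" if "q \<in> elts P" for q using decidesD[OF assms(1)] that by blast
    then show "ExistsIn F (chk a) \<Phi> p"
      unfolding ExistsIn_F using M_check_intro[OF x(1)] refl leqD name_check by metis
  qed
qed

text \<open>This quantifier of \<open>is_limit\<close> is not written as a bounded one, but its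
  witnesses are elements of \<open>x\<close>, so they can be taken to be check names.\<close>

lemma decides_nonempty:
  "decides (Exists F (\<lambda>y. Mem F y (chk x))) (Exists universe (\<lambda>y. Mem universe y x))"
  unfolding decides_def Exists_F F_simps universe_simps
  using M_check_elim M_check_intro refl leqD name_check by metis

lemma decides_is_pair: "decides (is_pair F (chk z) (chk x) (chk y)) (is_pair universe z x y)"
  unfolding decides_def by (simp add: is_pair_F E_check_iff)

lemma mono_is_pair: "mono (is_pair F z x y)"
  unfolding is_pair_def by (intro F.mono_Forall F.mono_derived)

lemma decides_maps_to: "decides (maps_to F (chk f) (chk x) (chk y)) (maps_to universe f x y)"
  unfolding maps_to_def
  by (intro decides_ExistsIn decides_is_pair mono_is_pair F.equiv_formulas E_refl; assumption)

lemma decides_is_ordinal: "decides (is_ordinal F (chk x)) (is_ordinal universe x)"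
  unfolding is_ordinal_def is_transitive_def is_subset_def
  by (intro decides_connectives decides_ForallIn F.equiv_intros; assumption)

lemma decides_is_limit: "decides (is_limit F (chk x)) (is_limit universe x)"
  unfolding is_limit_def
  by (intro decides_connectives decides_ForallIn decides_ExistsIn decides_is_ordinal decides_nonempty
      F.equiv_intros F.mono_connectives; assumption)

lemma decides_is_omega: "decides (is_omega F (chk x)) (is_omega universe x)"
  unfolding is_omega_def
  by (intro decides_connectives decides_ForallIn decides_is_limit F.equiv_rules F.equiv_formulas; assumption)

lemma decides_is_injection:
  "decides (is_injection F (chk f) (chk a) (chk b)) (is_injection universe f a b)"
  unfolding is_injection_def
  by (intro decides_connectives decides_derived decides_ForallIn decides_ExistsIn decides_is_pair
      decides_maps_to F.equiv_rules F.equiv_derived F.equiv_quantifiers F.equiv_formulas E_refl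
      F.mono_derived mono_is_pair; assumption)

text \<open>By absoluteness an injection into \<open>omega\<close> from the universe remains one,
  and its check name is the witness.\<close>

lemma forces_countable:
  assumes "countable (elts a)" "p \<in> elts P"
  shows "is_countable F (chk a) p"
proof -
  obtain f where "is_injection universe f a omega" using injection_to_omega[OF assms(1)] .
  then have inj: "Exists F (\<lambda>f. is_injection F f (chk a) (chk omega)) q" if "q \<in> elts P" for q
    unfolding Exists_F
    using decidesD[OF decides_is_injection[of f a omega]] refl leqD name_check[of f] by metis
  have om: "is_omega F (chk omega) q" if "q \<in> elts P" for q
    using decidesD[OF decides_is_omega that] by simp
  show ?thesis
    unfolding is_countable_def Exists_F[of _ p] F_simps
  proof (intro allI impI)
    fix q assume "q \<preceq> p"
    then have "q \<in> elts P" using leqD by blast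
    then show "\<exists>q' \<sigma>. q' \<preceq> q \<and> forcing_name P \<sigma> \<and> is_omega F \<sigma> q' \<and>
        Exists F (\<lambda>f. is_injection F f (chk a) \<sigma>) q'"
      using inj om refl name_check[of omega] by metis
  qed
qed

section \<open>The countable chain condition and preservation of \<open>omega1\<close>\<close>

definition ccc :: bool where
  "ccc \<longleftrightarrow> (\<forall>A\<subseteq>elts P.
     (\<forall>p\<in>A. \<forall>q\<in>A. \<forall>s. s \<preceq> p \<longrightarrow> s \<preceq> q \<longrightarrow> p = q) \<longrightarrow> countable A)"

lemma ccc_preserves_omega1:
  assumes ccc
  shows "preserves_omega1 P r"
  unfolding preserves_omega1_def is_omega1_def F_simps
proof (intro ballI conjI allI impI notI)
  fix p assume p: "p \<in> elts P"
  show "is_ordinal F (chk omega1) p"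
    using decidesD[OF decides_is_ordinal p] Ord_omega1 by simp
  show "ForallIn F (chk omega1) (is_countable F) p"
    unfolding ForallIn_F
  proof (intro allI impI)
    fix \<sigma> q assume "q \<preceq> p" "M q \<sigma> (chk omega1)"
    then obtain q' x where q': "q' \<preceq> q" "x \<in> elts omega1" "E q' \<sigma> (chk x)"
      using M_check_elim leqD by blast
    have P: "q' \<in> elts P" using q' leqD by blast
    have "is_countable F (chk x) q'" using forces_countable[OF countable_in_omega1] q' P by blast
    then have "is_countable F \<sigma> q'"
      using equiv_belowD[OF F.equiv_formulas(8)[OF q'(3) E_refl E_refl] P] by blast
    then show "\<exists>q'. q' \<preceq> q \<and> is_countable F \<sigma> q'" using q' by blast
  qed
next
  fix p q assume "p \<in> elts P" "q \<preceq> p" "is_countable F (chk omega1) q"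
  then have "countable (elts omega1 :: 'v set)"
    using F.countable_if_forced_countable[of omega1 q] assms leqD name_check unfolding ccc_def
    by metis
  then show False using uncountable_omega1 by blast
qed

end

section \<open>Forcing with a Suslin tree\<close>

text \<open>Conditions are the nodes of a tree, ordered upside down, so that compatible conditions are
  comparable.\<close>

locale suslin_forcing = forcing_notion P r for P :: "'v::zfc" and r +
  assumes P_omega1: "elts P \<subseteq> elts omega1"
    and compatible: "s \<preceq> p \<Longrightarrow> s \<preceq> q \<Longrightarrow> p \<preceq> q \<or> q \<preceq> p"
    and uncountable_cone: "p \<in> elts P \<Longrightarrow> uncountable {q. q \<preceq> p}"
    and countable_chain: "A \<subseteq> elts P \<Longrightarrow> (\<And>p q. p \<in> A \<Longrightarrow> q \<in> A \<Longrightarrow> p \<preceq> q \<or> q \<preceq> p) \<Longrightarrow> countable A"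
    and countable_antichain: "A \<subseteq> elts P \<Longrightarrow> (\<And>p q. p \<in> A \<Longrightarrow> q \<in> A \<Longrightarrow> p \<preceq> q \<Longrightarrow> p = q) \<Longrightarrow> countable A"
begin

text \<open>Comparable conditions are compatible, by reflexivity. So no two members of a family of
  pairwise incompatible conditions are comparable, and \<open>countable_antichain\<close>
  applies.\<close>

lemma ccc: ccc
  unfolding ccc_def using countable_antichain refl by (metis subsetD)

text \<open>If no \<open>q\<close> worked, every \<open>q\<close> below \<open>p\<close> would be
  compatible with some \<open>x\<close> in \<open>C\<close> without lying below it, hence would lie
  above \<open>x\<close>. The cone of \<open>p\<close> would be covered by the sets of conditions
  above single elements of \<open>C\<close>. These are countably many chains, each of them
  countable.\<close>

lemma decide_countable:
  assumes "countable C" and p: "p \<in> elts P"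
  obtains q where "q \<preceq> p" "\<And>x s. x \<in> C \<Longrightarrow> s \<preceq> q \<Longrightarrow> s \<preceq> x \<Longrightarrow> q \<preceq> x"
proof (rule ccontr)
  note give = that
  assume "\<not> thesis"
  then have *: "\<exists>x\<in>C. \<exists>s. s \<preceq> q \<and> s \<preceq> x \<and> \<not> q \<preceq> x" if "q \<preceq> p" for q
    using that give by blast
  have "{q. q \<preceq> p} \<subseteq> (\<Union>x\<in>C. {q. x \<preceq> q})" using * compatible by blast
  moreover have "countable {q. x \<preceq> q}" for x
    by (rule countable_chain) (use compatible leqD in blast)+
  then have "countable (\<Union>x\<in>C. {q. x \<preceq> q})" using assms(1) by blast
  ultimately show False using uncountable_cone[OF p] countable_subset by blast
qed

text \<open>A name for the generic branch together with its strict upper bound \<open>\<omega>\<^sub>1\<close>, so that the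
  supremum of the set is \<open>\<omega>\<^sub>1\<close> even where the branch is bounded.\<close>

definition branch :: 'v where
  "branch = set_of ({vpair (chk x) t |x t. t \<preceq> x} \<union> {vpair (chk omega1) t |t. t \<in> elts P})"

lemma elts_branch:
  "elts branch = {vpair (chk x) t |x t. t \<preceq> x} \<union> {vpair (chk omega1) t |t. t \<in> elts P}"
proof -
  let ?Y = "set_of (insert (chk omega1) (chk ` elts P))"
  have "{vpair (chk x) t |x t. t \<preceq> x} \<union> {vpair (chk omega1) t |t. t \<in> elts P}
      \<subseteq> {vpair y p |y p. y \<in> elts ?Y \<and> p \<in> elts P}"
    using leqD by auto
  then show ?thesis unfolding branch_def by (intro elts_set_of small_subset[OF small_products])
qed

lemma name_branch: "forcing_name P branch"
proof (rule forcing_name.intros)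
  fix z assume "z \<in> elts branch"
  then show "\<exists>\<sigma> p. z = vpair \<sigma> p \<and> forcing_name P \<sigma> \<and> p \<in> elts P"
    unfolding elts_branch using name_check leqD by blast
qed

lemma branch_intro: "q \<preceq> x \<Longrightarrow> M q (chk x) branch"
  by (rule M_intro[where s = q]) (auto simp: elts_branch refl leqD)

lemma branch_intro_top: "q \<in> elts P \<Longrightarrow> M q (chk omega1) branch"
  by (rule M_intro[where s = q]) (auto simp: elts_branch refl)

lemma branch_elim:
  assumes "M p \<sigma> branch" "p \<in> elts P"
  obtains q x where "q \<preceq> p" "E q \<sigma> (chk x)" "x = omega1 \<or> q \<preceq> x"
proof -
  obtain q \<rho> t where q: "q \<preceq> p" "vpair \<rho> t \<in> elts branch" "q \<preceq> t" "E q \<sigma> \<rho>"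
    using M_elim[OF assms] .
  then consider x where "\<rho> = chk x" "t \<preceq> x" | "\<rho> = chk omega1" by (auto simp: elts_branch)
  then show thesis using that q trans by cases blast+
qed

lemma branch_decided:
  assumes "M p (chk x) branch" "p \<in> elts P" "x \<in> elts P"
  obtains q where "q \<preceq> p" "q \<preceq> x"
proof -
  obtain q y where q: "q \<preceq> p" "E q (chk x) (chk y)" "y = omega1 \<or> q \<preceq> y"
    using branch_elim[OF assms(1,2)] .
  then have "x = y" using E_check_iff leqD by blast
  moreover have "x \<noteq> omega1" using assms(3) P_omega1 mem_irrefl by blast
  ultimately show thesis using that q by blast
qed

text \<open>\<open>omega1\<close> is an element of the set, and every other element is a countable
  ordinal and so a subset of \<open>omega1\<close>.\<close>

lemma forces_branch_sup:
  assumes p: "p \<in> elts P"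
  shows "is_union F (chk omega1) branch p"
  unfolding is_union_def
proof (subst comprehension_iff[OF name_check p])
  show "E p (chk omega1) (chk omega1)" by (rule E_refl)
  show "equiv_below q (ExistsIn F branch (Mem F u)) (ExistsIn F branch (Mem F u'))"
    if "E q u u'" for q u u'
    using that by (intro equiv_intros_F)
  show "ExistsIn F branch (Mem F (chk w)) q" if "w \<in> elts omega1" "q \<preceq> p" for w q
    by (intro ExistsIn_F_intro[where \<sigma> = "chk omega1"])
      (auto intro: M_check_intro branch_intro_top leqD that)
  fix u q assume *: "forcing_name P u" "q \<preceq> p" "ExistsIn F branch (Mem F u) q"
  then obtain q1 y where 1: "q1 \<preceq> q" "M q1 y branch" "M q1 u y"
    using refl leqD unfolding ExistsIn_F F_simps by blast
  then obtain q2 x where 2: "q2 \<preceq> q1" "E q2 y (chk x)" "x = omega1 \<or> q2 \<preceq> x"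
    using branch_elim leqD by blast
  have "elts x \<subseteq> elts omega1"
    using 2(3) leqD P_omega1 Ord_trans[OF Ord_omega1] by blast
  moreover have "M q2 u (chk x)" using M_cong[OF M_mono[OF 1(3) 2(1)] E_refl 2(2)] .
  ultimately have "M q2 u (chk omega1)" using M_check_subset leqD 2 by blast
  then obtain q3 w where "q3 \<preceq> q2" "w \<in> elts omega1" "E q3 u (chk w)"
    using M_check_elim leqD 2 by blast
  then show "\<exists>q' w. q' \<preceq> q \<and> w \<in> elts omega1 \<and> E q' u (chk w)"
    using 1 2 trans by blast
qed

section \<open>What is forced about a suitable model \<open>N\<close>\<close>

context
  fixes N \<Omega>
  assumes N: "Transset N" and \<Omega>: "\<Omega> \<in> elts N" "elts \<Omega> = insert omega1 (elts omega1)"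
    and N_closed: "\<And>a t. a \<in> elts N \<Longrightarrow> t \<in> elts P \<Longrightarrow>
      set_of (elts a \<inter> insert omega1 {x. t \<preceq> x}) \<in> elts N"
begin

lemma \<Omega>_sub: "elts \<Omega> \<subseteq> elts N"
  using N \<Omega> unfolding Transset_def by blast

text \<open>The interpretation relativized to \<open>N\<close> yields that \<open>a\<close> is
  countable in the universe, so \<open>decide_countable\<close> provides \<open>t\<close>. Below
  \<open>t\<close> the intersection equals the check name of \<open>b\<close>, a set that
  \<open>N_closed\<close> puts into \<open>N\<close>.\<close>

lemma forces_countably_approximated:
  assumes p: "p \<in> elts P"
  shows "countably_approximated F branch (chk N) p"
  unfolding countably_approximated_def is_subset_def F_simps(4)
proof (intro conjI)
  have *: "\<exists>q'. q' \<preceq> q \<and> M q' \<sigma> (chk N)" if q: "M q \<sigma> branch" "q \<preceq> p" for q \<sigma>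
  proof -
    obtain q' x where q': "q' \<preceq> q" "E q' \<sigma> (chk x)" "x = omega1 \<or> q' \<preceq> x"
      using branch_elim[OF q(1) leqD(1)[OF q(2)]] by blast
    have "x \<in> elts N" using q'(3) leqD P_omega1 \<Omega>_sub \<Omega>(2) by blast
    then have "M q' \<sigma> (chk N)"
      using M_cong[OF M_check_intro E_sym[OF q'(2)] E_refl] q' leqD by blast
    then show ?thesis using q' by blast
  qed
  then show "ForallIn F branch (\<lambda>z. Mem F z (chk N)) p" unfolding ForallIn_F F_simps by blast
  interpret R: forcing_interp P r "relativize F (chk N)" "\<lambda>p \<sigma>. forcing_name P \<sigma> \<and> M p \<sigma> (chk N)"
    by (rule forcing_interp_relativize[OF N])
  show "ForallIn F (chk N) (\<lambda>a. Imp F (is_countable (relativize F (chk N)) a)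
      (ExistsIn F (chk N) (\<lambda>x. is_inter F x branch a))) p"
    unfolding ForallIn_F
  proof (intro allI impI)
    fix \<sigma> q assume "q \<preceq> p" "M q \<sigma> (chk N)"
    then obtain q1 a where q1: "q1 \<preceq> q" "a \<in> elts N" "E q1 \<sigma> (chk a)"
      using M_check_elim leqD by blast
    have "Imp F (is_countable (relativize F (chk N)) \<sigma>)
      (ExistsIn F (chk N) (\<lambda>x. is_inter F x branch \<sigma>)) q1"
      unfolding Imp_F
    proof (intro allI impI)
      fix q2 assume q2: "q2 \<preceq> q1" "is_countable (relativize F (chk N)) \<sigma> q2"
      have P2: "q2 \<in> elts P" using q2 leqD by blast
      have Eq2: "E q2 \<sigma> (chk a)" using E_mono q1 q2 by blast
      have "is_countable (relativize F (chk N)) (chk a) q2"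
        using q2(2) equiv_belowD[OF R.equiv_formulas(8)[OF Eq2 E_refl E_refl] P2] by blast
      then have "countable (elts a)"
        using R.countable_if_forced_countable[of a q2] ccc M_check_intro[OF q1(2)] P2 name_check
        unfolding ccc_def by metis
      then obtain t where t: "t \<preceq> q2" "\<And>x s. x \<in> elts a \<Longrightarrow> s \<preceq> t \<Longrightarrow> s \<preceq> x \<Longrightarrow> t \<preceq> x"
        using decide_countable[of "elts a" q2] P2 by blast
      have Pt: "t \<in> elts P" using t leqD by blast
      define b where "b = set_of (elts a \<inter> insert omega1 {x. t \<preceq> x})"
      have elts_b: "elts b = elts a \<inter> insert omega1 {x. t \<preceq> x}"
        unfolding b_def by (rule elts_set_of[OF small_subset[OF small_elts]]) blast
      have bN: "b \<in> elts N" unfolding b_def by (rule N_closed[OF q1(2) Pt])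
      have "is_inter F (chk b) branch (chk a) s" if s: "s \<preceq> t" for s
        unfolding is_inter_def
      proof (subst comprehension_iff[OF name_check])
        show "E s (chk b) (chk b)" by (rule E_refl)
        show "s \<in> elts P" using s leqD by blast
        show "Conj F (Mem F (chk w) branch) (Mem F (chk w) (chk a)) q"
          if "w \<in> elts b" "q \<preceq> s" for w q
        proof -
          have "q \<in> elts P" "q \<preceq> t" using that(2) s trans leqD by blast+
          moreover have "w \<in> elts a" "w = omega1 \<or> t \<preceq> w" using that(1) elts_b by auto
          ultimately show ?thesis
            using M_check_intro branch_intro[OF trans[of q t w]] branch_intro_top by auto
        qed
        show "equiv_below q (Conj F (Mem F u branch) (Mem F u (chk a)))
            (Conj F (Mem F u' branch) (Mem F u' (chk a)))" if "E q u u'" for q u u'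
          using that by (intro equiv_intros_F)
        fix u q
        assume "q \<preceq> s" "Conj F (Mem F u branch) (Mem F u (chk a)) q"
        then obtain q' x where q': "q' \<preceq> q" "E q' u (chk x)" "x = omega1 \<or> q' \<preceq> x" "M q u (chk a)"
          using branch_elim leqD by (metis F_simps(1,4))
        then have "M q' (chk x) (chk a)" using M_cong M_mono E_refl by blast
        then have "x \<in> elts a" using M_check_iff q' leqD by blast
        moreover have "q' \<preceq> t" using q' \<open>q \<preceq> s\<close> s trans by blast
        \<comment> \<open>\<open>q'\<close> is below \<open>t\<close>. If it is also below a node
          \<open>x\<close> in \<open>a\<close>, then by the choice of \<open>t\<close> already
          \<open>t\<close> is below \<open>x\<close>: no stronger condition puts a new element of
          \<open>a\<close> into the branch.\<close>
        ultimately have "x \<in> elts b" using t(2) q'(3) unfolding elts_b by blast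
        then show "\<exists>q' w. q' \<preceq> q \<and> w \<in> elts b \<and> E q' u (chk w)" using q' by blast
      qed
      moreover have "equiv_below s (is_inter F (chk b) branch (chk a)) (is_inter F (chk b) branch \<sigma>)"
        if "s \<preceq> t" for s
        unfolding is_inter_def
        using E_sym[OF E_mono[OF Eq2 trans[OF that t(1)]]] by (intro equiv_intros_F)
      ultimately have "is_inter F (chk b) branch \<sigma> s" if "s \<preceq> t" for s
        using that equiv_belowD leqD by blast
      then have "ExistsIn F (chk N) (\<lambda>x. is_inter F x branch \<sigma>) t"
        unfolding ExistsIn_F using M_check_intro[OF bN] name_check refl leqD by blast
      then show "\<exists>q'. q' \<preceq> q2 \<and> ExistsIn F (chk N) (\<lambda>x. is_inter F x branch \<sigma>) q'"
        using t by blast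
    qed
    then show "\<exists>q'. q' \<preceq> q \<and> Imp F (is_countable (relativize F (chk N)) \<sigma>)
      (ExistsIn F (chk N) (\<lambda>x. is_inter F x branch \<sigma>)) q'"
      using q1 by blast
  qed
qed

text \<open>Membership in \<open>e\<close> is decided in the universe. A node \<open>x\<close> below
  \<open>q1\<close> forces itself into the branch, so it is in \<open>e\<close>. Conversely
  \<open>x\<close> forces any other such node \<open>y\<close>, being in \<open>e\<close> and in
  \<open>N\<close>, to be densely in the branch, so \<open>x\<close> and \<open>y\<close> are
  compatible and hence comparable.\<close>

lemma not_forced_guessed: "p \<in> elts P \<Longrightarrow> \<not> guessed F branch (chk N) p"
proof
  assume p: "p \<in> elts P" and "guessed F branch (chk N) p"
  then obtain q e0 where q: "q \<preceq> p" "M q e0 (chk N)" "is_inter F branch e0 (chk N) q"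
    unfolding guessed_def ExistsIn_F using refl by blast
  obtain q1 e where q1: "q1 \<preceq> q" "E q1 e0 (chk e)"
    using M_check_elim[OF q(2) leqD(1)[OF q(1)]] by blast
  have P1: "q1 \<in> elts P" using q1 leqD by blast
  have inter1: "\<exists>s'. s' \<preceq> s \<and> M s' (chk x) e0" if "s \<preceq> q" "M s (chk x) branch" for x s
    using q(3) that name_check unfolding is_inter_def F_simps Iff_F by blast
  have inter2: "\<exists>s'. s' \<preceq> s \<and> M s' (chk x) branch"
    if "s \<preceq> q" "M s (chk x) e0" "M s (chk x) (chk N)" for x s
    using q(3) that name_check unfolding is_inter_def F_simps Iff_F by blast
  have mem: "x \<in> elts e" if x: "x \<preceq> q1" for x
  proof -
    obtain s where s: "s \<preceq> x" "M s (chk x) e0"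
      using inter1[OF trans[OF x q1(1)] branch_intro[OF refl[OF leqD(1)[OF x]]]] by blast
    have "s \<preceq> q1" using s x trans by blast
    then have "M s (chk x) (chk e)" using M_cong[OF s(2) E_refl E_mono[OF q1(2)]] by blast
    then show ?thesis using M_check_iff s leqD by blast
  qed
  have "x \<preceq> y \<or> y \<preceq> x" if x: "x \<preceq> q1" and y: "y \<preceq> q1" for x y
  proof -
    have XP: "x \<in> elts P" "y \<in> elts P" using that leqD by blast+
    have "y \<in> elts N" using XP P_omega1 \<Omega>_sub \<Omega>(2) by blast
    then have "M x (chk y) (chk N)" using M_check_intro XP by blast
    moreover have "M x (chk y) e0"
      using M_cong[OF M_check_intro[OF mem[OF y]] E_refl E_sym[OF E_mono[OF q1(2) x]]] XP by blast
    moreover have "x \<preceq> q" using x q1 trans by blast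
    ultimately obtain s where s: "s \<preceq> x" "M s (chk y) branch" using inter2 by blast
    then obtain s' where "s' \<preceq> s" "s' \<preceq> y" using branch_decided XP leqD by blast
    then show ?thesis using compatible s trans by blast
  qed
  then have "countable {x. x \<preceq> q1}" by (intro countable_chain) (use leqD in blast)+
  then show False using uncountable_cone[OF P1] by blast
qed

lemma not_indestructibly_guessing: "\<not> indestructibly_omega1_guessing N"
proof
  assume "indestructibly_omega1_guessing N"
  then have guess: "omega1_guessing F (chk N) p" if "p \<in> elts P" for p
    using poset ccc_preserves_omega1[OF ccc] that unfolding indestructibly_omega1_guessing_def
    by blast
  obtain p where p: "p \<in> elts P" using poset unfolding forcing_poset_def by blast
  define o' where "o' = set_of {x \<in> elts N. Ord x}"
  have elts_o: "elts o' = {x \<in> elts N. Ord x}"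
    unfolding o'_def by (rule elts_set_of[OF small_subset[OF small_elts]]) blast
  have "Transset y \<and> elts y \<subseteq> elts \<Omega>" if "y \<in> elts \<Omega>" for y
    using that Ord_omega1 Ord_trans[OF Ord_omega1, of _ y] unfolding \<Omega>(2) Ord_def by auto
  then have Ord_\<Omega>: "Ord \<Omega>" unfolding Ord_def Transset_def[of \<Omega>] by blast
  then have \<Omega>_o: "\<Omega> \<in> elts o'" "elts \<Omega> \<subseteq> elts o'"
    using \<Omega> \<Omega>_sub Ord_in_Ord unfolding elts_o by blast+
  \<comment> \<open>Being an ordinal is absolute, so in the extension \<open>N\<close> has the
    ordinals \<open>o'\<close> computed in the universe, and \<open>chk o'\<close> instantiates the
    first quantifier of \<open>omega1_guessing\<close>.\<close>
  have ordinals: "Forall F (\<lambda>x. Iff F (Mem F x (chk o')) (Conj F (Mem F x (chk N)) (is_ordinal F x))) p"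
  proof (subst comprehension_iff[OF name_check p])
    show "E p (chk o') (chk o')" by (rule E_refl)
    show "Conj F (Mem F (chk w) (chk N)) (is_ordinal F (chk w)) q" if "w \<in> elts o'" "q \<preceq> p" for w q
    proof -
      have "w \<in> elts N" "Ord w" "q \<in> elts P" using that elts_o leqD by blast+
      then show ?thesis using M_check_intro decidesD[OF decides_is_ordinal[of w]] by simp
    qed
    show "equiv_below q (Conj F (Mem F u (chk N)) (is_ordinal F u))
        (Conj F (Mem F u' (chk N)) (is_ordinal F u'))" if "E q u u'" for q u u'
      using that by (intro equiv_intros_F equiv_formulas_F)
    fix u q assume "Conj F (Mem F u (chk N)) (is_ordinal F u) q" "q \<preceq> p"
    then have q: "M q u (chk N)" "is_ordinal F u q" "q \<in> elts P" using leqD by auto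
    obtain q' w where q': "q' \<preceq> q" "w \<in> elts N" "E q' u (chk w)" using M_check_elim[OF q(1,3)] .
    have P': "q' \<in> elts P" using q' leqD by blast
    have "mono (is_ordinal F u)" unfolding is_ordinal_def is_transitive_def
      by (intro mono_F)
    then have "is_ordinal F u q'" using monoD q q' by blast
    then have "is_ordinal F (chk w) q'"
      using equiv_belowD[OF equiv_formulas_F(2)[OF q'(3) E_refl E_refl] P'] by blast
    then have "Ord w" using decidesD[OF decides_is_ordinal P'] by simp
    then show "\<exists>q' w. q' \<preceq> q \<and> w \<in> elts o' \<and> E q' u (chk w)" using q' elts_o by blast
  qed
  obtain q where q: "q \<preceq> p" "Forall F (\<lambda>d. Imp F
       (Conj F (is_subset F d (chk o'))
       (Conj F (Exists F (\<lambda>s. Exists F (\<lambda>s'.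
                  Conj F (is_union F s d) (Conj F (is_union F s' (chk o')) (Mem F s s')))))
               (countably_approximated F d (chk N))))
       (guessed F d (chk N))) q"
    using Imp_F_elim[OF Forall_F_elim[OF guess[OF p, unfolded omega1_guessing_def]
          name_check[of o']] ordinals p] by blast
  have P: "q \<in> elts P" using q leqD by blast
  have "is_subset F branch (chk o') q"
    unfolding is_subset_def ForallIn_F F_simps
  proof (intro allI impI)
    fix \<sigma> q1 assume "q1 \<preceq> q" "M q1 \<sigma> branch"
    then obtain q2 x where q2: "q2 \<preceq> q1" "E q2 \<sigma> (chk x)" "x = omega1 \<or> q2 \<preceq> x"
      using branch_elim leqD by blast
    then have "x \<in> elts o'" using leqD P_omega1 \<Omega>_o \<Omega>(2) by blast
    then have "M q2 \<sigma> (chk o')"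
      using M_cong[OF M_check_intro E_sym[OF q2(2)] E_refl] q2 leqD by blast
    then show "\<exists>q'. q' \<preceq> q1 \<and> M q' \<sigma> (chk o')" using q2 by blast
  qed
  moreover have "Exists F (\<lambda>s. Exists F (\<lambda>s'.
      Conj F (is_union F s branch) (Conj F (is_union F s' (chk o')) (Mem F s s')))) q"
  proof -
    define S where "S = set_of (\<Union>x\<in>elts o'. elts x)"
    have elts_S: "elts S = (\<Union>x\<in>elts o'. elts x)"
      unfolding S_def by (rule elts_set_of[OF small_UN]) simp_all
    have un: "is_union F (chk S) (chk o') s" if s: "s \<in> elts P" for s
      unfolding is_union_def
    proof (subst comprehension_iff[OF name_check s])
      show "E s (chk S) (chk S)" by (rule E_refl)
      show "equiv_below q (ExistsIn F (chk o') (Mem F u)) (ExistsIn F (chk o') (Mem F u'))"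
        if "E q u u'" for q u u'
        using that by (intro equiv_intros_F)
      show "ExistsIn F (chk o') (Mem F (chk w)) q" if w: "w \<in> elts S" "q \<preceq> s" for w q
      proof -
        obtain x where "x \<in> elts o'" "w \<in> elts x" using w elts_S by blast
        then show ?thesis
          by (intro ExistsIn_F_intro[where \<sigma> = "chk x"]) (auto intro: M_check_intro leqD)
      qed
      fix u q assume "q \<preceq> s" "ExistsIn F (chk o') (Mem F u) q"
      then obtain q1 y where 1: "q1 \<preceq> q" "M q1 y (chk o')" "M q1 u y"
        using refl leqD unfolding ExistsIn_F F_simps by blast
      then obtain q2 x where 2: "q2 \<preceq> q1" "x \<in> elts o'" "E q2 y (chk x)"
        using M_check_elim leqD by blast
      then have "M q2 u (chk x)" using M_cong[OF M_mono[OF 1(3) 2(1)] E_refl] by blast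
      then obtain q3 w where "q3 \<preceq> q2" "w \<in> elts x" "E q3 u (chk w)"
        using M_check_elim leqD 2 by blast
      then show "\<exists>q' w. q' \<preceq> q \<and> w \<in> elts S \<and> E q' u (chk w)"
        using 1 2 trans elts_S by blast
    qed
    \<comment> \<open>\<open>omega1\<close> is an element of the ordinal \<open>\<Omega>\<close>,
      which is itself in \<open>N\<close>. Thus the supremum of the branch is strictly below the
      supremum \<open>S\<close> of the ordinals of \<open>N\<close>.\<close>
    have "omega1 \<in> elts S" using \<Omega>_o \<Omega>(2) elts_S by blast
    then have "Conj F (is_union F (chk omega1) branch)
        (Conj F (is_union F (chk S) (chk o')) (Mem F (chk omega1) (chk S))) s" if "s \<in> elts P" for s
      using that un forces_branch_sup M_check_intro by simp
    then show ?thesis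
      unfolding Exists_F using refl leqD name_check by metis
  qed
  ultimately have "Conj F (is_subset F branch (chk o'))
      (Conj F (Exists F (\<lambda>s. Exists F (\<lambda>s'.
          Conj F (is_union F s branch) (Conj F (is_union F s' (chk o')) (Mem F s s')))))
        (countably_approximated F branch (chk N))) q"
    using forces_countably_approximated[OF P] by simp
  then have "\<exists>q'. q' \<preceq> q \<and> guessed F branch (chk N) q'"
    using Imp_F_elim[OF Forall_F_elim[OF q(2) name_branch] _ P] by blast
  then show False using not_forced_guessed leqD by blast
qed

end

end

section \<open>Clubs of closed sets\<close>

text \<open>By \<open>less_omega2_iff\<close> this is the size bound of \<open>P_omega2\<close> and
  \<open>H_omega2\<close>, in the form suited to bounding unions indexed by \<omega>_1 many
  sets.\<close>

definition le_omega1 :: "'a set \<Rightarrow> bool" where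
  "le_omega1 A \<longleftrightarrow> |A| \<le>o omega1_card"

lemma infinite_Field_omega1_card: "infinite (Field omega1_card)"
  using cardSuc_finite[OF natLeq_Card_order] by (simp add: Field_natLeq)

lemma le_omega1_subset: "le_omega1 B \<Longrightarrow> A \<subseteq> B \<Longrightarrow> le_omega1 A"
  unfolding le_omega1_def using card_of_mono1 ordLeq_transitive by blast

lemma le_omega1_image: "le_omega1 A \<Longrightarrow> le_omega1 (f ` A)"
  unfolding le_omega1_def using card_of_image ordLeq_transitive by blast

lemma le_omega1_UN: "le_omega1 I \<Longrightarrow> (\<And>i. i \<in> I \<Longrightarrow> le_omega1 (A i)) \<Longrightarrow> le_omega1 (\<Union>i\<in>I. A i)"
  unfolding le_omega1_def
  by (rule card_of_UNION_ordLeq_infinite_Field)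
    (use infinite_Field_omega1_card Card_order_omega1_card in auto)

lemma le_omega1_countable: "countable A \<Longrightarrow> le_omega1 A"
  unfolding le_omega1_def countable_iff_less_omega1 by (rule ordLess_imp_ordLeq)

lemma le_omega1_Un: "le_omega1 A \<Longrightarrow> le_omega1 B \<Longrightarrow> le_omega1 (A \<union> B)"
  using le_omega1_UN[of "{True, False}" "\<lambda>i. if i then A else B"] le_omega1_countable[of "{True, False}"]
  by (simp add: Un_commute)

lemma P_omega2_iff: "a \<in> P_omega2 X \<longleftrightarrow> a \<subseteq> X \<and> le_omega1 a"
  unfolding P_omega2_def le_omega1_def using less_omega2_iff by blast

text \<open>For unboundedness, close off under \<open>G\<close> in countably many stages; the union
  still has size at most \<omega>_1. Unions of chains stay closed because \<open>G\<close> depends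
  on a single element.\<close>

lemma club_closed_sets:
  assumes B: "B \<subseteq> X" "le_omega1 B"
    and G: "\<And>x. x \<in> X \<Longrightarrow> G x \<subseteq> X" "\<And>x. x \<in> X \<Longrightarrow> le_omega1 (G x)"
  shows "club_P_omega2 X {a \<in> P_omega2 X. B \<subseteq> a \<and> (\<forall>x\<in>a. G x \<subseteq> a)}"
    (is "club_P_omega2 X ?C")
  unfolding club_P_omega2_def
proof (intro conjI ballI allI impI)
  show "?C \<subseteq> P_omega2 X" by blast
next
  fix a assume a: "a \<in> P_omega2 X"
  define S where "S n = ((\<lambda>A. A \<union> (\<Union>x\<in>A. G x)) ^^ n) (a \<union> B)" for n
  have S_Suc: "S (Suc n) = S n \<union> (\<Union>x\<in>S n. G x)" for n unfolding S_def by simp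
  have S: "S n \<subseteq> X \<and> le_omega1 (S n)" for n
  proof (induction n)
    case 0
    then show ?case using a B by (auto simp: S_def P_omega2_iff intro: le_omega1_Un)
  next
    case (Suc n)
    have "le_omega1 (\<Union>x\<in>S n. G x)" by (rule le_omega1_UN) (use Suc G in blast)+
    then show ?case using Suc G unfolding S_Suc by (blast intro: le_omega1_Un)
  qed
  have "le_omega1 (\<Union>n. S n)"
    by (rule le_omega1_UN) (use S le_omega1_countable[of "UNIV :: nat set"] in auto)
  then have "(\<Union>n. S n) \<in> P_omega2 X" using S by (auto simp: P_omega2_iff)
  moreover have "a \<union> B \<subseteq> (\<Union>n. S n)"
  proof -
    have "S 0 = a \<union> B" unfolding S_def by simp
    then show ?thesis by blast
  qed
  moreover have "G x \<subseteq> (\<Union>n. S n)" if "x \<in> (\<Union>n. S n)" for x using that S_Suc by blast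
  ultimately show "\<exists>b\<in>?C. a \<subseteq> b" by blast
next
  fix \<D> assume D: "\<D> \<subseteq> ?C \<and> \<D> \<noteq> {} \<and> chain\<^sub>\<subseteq> \<D> \<and> |\<D>| <o omega2_card"
  then have "le_omega1 \<D>" unfolding le_omega1_def using less_omega2_iff by blast
  then have "le_omega1 (\<Union>d\<in>\<D>. d)"
    by (rule le_omega1_UN) (use D in \<open>auto simp: P_omega2_iff\<close>)
  moreover have "\<Union>\<D> \<subseteq> X" using D by (auto simp: P_omega2_iff)
  ultimately have "\<Union>\<D> \<in> P_omega2 X" by (simp add: P_omega2_iff)
  then show "\<Union>\<D> \<in> ?C" using D by blast
qed

section \<open>Closure properties of \<open>H_omega2\<close>\<close>

lemma trcl_unfold: "trcl x = elts x \<union> (\<Union>y\<in>elts x. trcl y)"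
proof -
  let ?R = "{(a, b). a \<in> elts (b :: 'a)}"
  have "(z, x) \<in> ?R\<^sup>+ \<longleftrightarrow> z \<in> elts x \<or> (\<exists>y\<in>elts x. (z, y) \<in> ?R\<^sup>+)" for z
    using trancl_unfold[of ?R] by blast
  then show ?thesis unfolding trcl_def by auto
qed

lemma H_omega2_iff: "x \<in> H_omega2 \<longleftrightarrow> le_omega1 (trcl x)"
  unfolding H_omega2_def le_omega1_def using less_omega2_iff by blast

lemma elts_subset_H_omega2:
  assumes "x \<in> H_omega2"
  shows "elts x \<subseteq> H_omega2" "le_omega1 (elts x)"
proof -
  note sub = le_omega1_subset[OF assms[unfolded H_omega2_iff]]
  have "trcl y \<subseteq> trcl x" if "y \<in> elts x" for y using that trcl_unfold[of x] by blast
  then show "elts x \<subseteq> H_omega2" using sub H_omega2_iff by blast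
  show "le_omega1 (elts x)" by (rule sub) (use trcl_unfold[of x] in blast)
qed

text \<open>The transitive closure is made of \<open>elts x\<close> and at most \<omega>_1 many
  further pieces, each of size at most \<omega>_1.\<close>

lemma H_omega2I:
  assumes "elts x \<subseteq> H_omega2" "le_omega1 (elts x)"
  shows "x \<in> H_omega2"
  unfolding H_omega2_iff trcl_unfold[of x]
  by (intro le_omega1_Un le_omega1_UN assms) (use assms in \<open>auto simp: H_omega2_iff\<close>)

lemma le_omega1_elts_omega1: "le_omega1 (elts omega1)"
  unfolding le_omega1_def using card_omega1 ordIso_imp_ordLeq by blast

lemma omega1_in_H_omega2: "omega1 \<in> H_omega2"
proof (rule H_omega2I[OF _ le_omega1_elts_omega1])
  have "x \<in> elts omega1 \<longrightarrow> x \<in> H_omega2" for x :: 'a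
  proof (induction x rule: elts_induct)
    case (step x)
    show ?case
      using step Ord_trans[OF Ord_omega1] le_omega1_countable[OF countable_in_omega1]
      by (blast intro: H_omega2I)
  qed
  then show "elts omega1 \<subseteq> (H_omega2 :: 'a set)" by blast
qed

lemma IGMP_omega2_no_suslin_forcing:
  assumes "IGMP_omega2 TYPE('v::zfc)"
  shows "\<not> suslin_forcing (P :: 'v) r"
proof
  assume P: "suslin_forcing P r"
  interpret suslin_forcing P r by (rule P)
  define \<Omega> :: 'v where "\<Omega> = set_of (insert omega1 (elts omega1))"
  have elts_\<Omega>: "elts \<Omega> = insert omega1 (elts omega1)" unfolding \<Omega>_def by simp
  define f where "f a t = set_of (elts a \<inter> insert omega1 {x. (t, x) \<in> r})" for a t
  have elts_f: "elts (f a t) = elts a \<inter> insert omega1 {x. (t, x) \<in> r}" for a t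
    unfolding f_def by (rule elts_set_of[OF small_subset[OF small_elts]]) blast
  have "le_omega1 (elts P)" using le_omega1_subset[OF le_omega1_elts_omega1 P_omega1] .
  moreover have "f a t \<in> H_omega2" if a: "a \<in> H_omega2" for a t
  proof (rule H_omega2I)
    show "elts (f a t) \<subseteq> H_omega2" using elts_subset_H_omega2(1)[OF a] elts_f by blast
    show "le_omega1 (elts (f a t))"
      by (rule le_omega1_subset[OF elts_subset_H_omega2(2)[OF a]]) (use elts_f in blast)
  qed
  moreover have "\<Omega> \<in> H_omega2"
  proof (rule H_omega2I)
    show "elts \<Omega> \<subseteq> H_omega2"
      unfolding elts_\<Omega> using omega1_in_H_omega2 elts_subset_H_omega2(1) by blast
    show "le_omega1 (elts \<Omega>)"
      unfolding elts_\<Omega> using le_omega1_Un[OF le_omega1_countable[of "{omega1}"] le_omega1_elts_omega1]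
      by simp
  qed
  \<comment> \<open>Closure under \<open>elts\<close> makes \<open>N\<close> transitive, and closure
    under \<open>f\<close> provides the approximations. Since \<open>P\<close> is a subset of
    \<open>omega1\<close>, each \<open>x\<close> calls for at most \<omega>_1 new elements.\<close>
  ultimately have "club_P_omega2 H_omega2 {a \<in> P_omega2 H_omega2. {\<Omega>} \<subseteq> a \<and>
      (\<forall>x\<in>a. elts x \<union> f x ` elts P \<subseteq> a)}" (is "club_P_omega2 _ ?C")
    using elts_subset_H_omega2
    by (intro club_closed_sets) (auto intro!: le_omega1_Un le_omega1_image le_omega1_countable[of "{\<Omega>}"])
  then have "{elts N |N. elts N \<in> P_omega2 H_omega2 \<and> indestructibly_omega1_guessing N} \<inter> ?C \<noteq> {}"
    using assms unfolding IGMP_omega2_def stationary_P_omega2_def by simp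
  then obtain N where "elts N \<in> ?C" "indestructibly_omega1_guessing N" by auto
  then have N: "indestructibly_omega1_guessing N" "\<Omega> \<in> elts N"
    "\<And>x. x \<in> elts N \<Longrightarrow> elts x \<subseteq> elts N" "\<And>x t. x \<in> elts N \<Longrightarrow> t \<in> elts P \<Longrightarrow> f x t \<in> elts N"
    by auto
  have "Transset N" using N(3) unfolding Transset_def by blast
  then show False
    using not_indestructibly_guessing[OF _ N(2) elts_\<Omega>] N(1,4) unfolding f_def by blast
qed

section \<open>Suslin trees and Suslin lines\<close>

text \<open>The hypothesis \<open>tree\<close> asks only that predecessors of a node be comparable,
  so the lemma serves both trees and the nested intervals of a line. What has to be arranged is that
  all cones are uncountable; for this the nodes with countable cones are discarded, and
  \<open>B\<close> is shown to be countable.\<close>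

lemma suslin_forcing_exists:
  fixes T :: "'a set"
  assumes po: "partial_order_on T r"
    and tree: "\<And>x y z. (x, z) \<in> r \<Longrightarrow> (y, z) \<in> r \<Longrightarrow> (x, y) \<in> r \<or> (y, x) \<in> r"
    and unc: "uncountable T"
    and chain: "\<And>A. A \<subseteq> T \<Longrightarrow> A \<in> Chains r \<Longrightarrow> countable A"
    and antichain: "\<And>A. A \<subseteq> T \<Longrightarrow> antichain r A \<Longrightarrow> countable A"
  shows "\<exists>(P::'v::zfc) r. suslin_forcing P r"
proof -
  let ?\<Omega> = "elts (omega1 :: 'v)"
  \<comment> \<open>Whatever the size and type of \<open>T\<close>, \<omega>_1 many of its nodes
    inherit the chain and antichain conditions. Indexing them by countable ordinals puts the poset
    into the universe.\<close>
  have "|?\<Omega>| \<le>o |T|"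
    using card_omega1 unc[unfolded uncountable_iff_omega1_le] ordIso_ordLeq_trans by blast
  then obtain g where g: "inj_on g ?\<Omega>" "g ` ?\<Omega> \<subseteq> T" unfolding card_of_ordLeq[symmetric] by blast
  define R where "R = {(x, y). x \<in> ?\<Omega> \<and> y \<in> ?\<Omega> \<and> (g y, g x) \<in> r}"
  have R_dom: "x \<in> ?\<Omega>" "y \<in> ?\<Omega>" if "(x, y) \<in> R" for x y using that unfolding R_def by auto
  have R_refl: "(x, x) \<in> R" if "x \<in> ?\<Omega>" for x
    using that po g unfolding R_def order_on_defs refl_on_def by auto
  have R_trans: "(x, z) \<in> R" if "(x, y) \<in> R" "(y, z) \<in> R" for x y z
    using that po unfolding R_def order_on_defs by (auto dest: transD)
  have R_antisym: "x = y" if "(x, y) \<in> R" "(y, x) \<in> R" for x y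
    using that po g(1) unfolding R_def order_on_defs by (auto dest: antisymD inj_onD)
  have R_tree: "(x, y) \<in> R \<or> (y, x) \<in> R" if "(z, x) \<in> R" "(z, y) \<in> R" for x y z
    using that tree unfolding R_def by auto
  have R_chain: "countable A"
    if A: "A \<subseteq> ?\<Omega>" "\<And>x y. x \<in> A \<Longrightarrow> y \<in> A \<Longrightarrow> (x, y) \<in> R \<or> (y, x) \<in> R" for A
  proof -
    have "countable (g ` A)"
    proof (rule chain)
      show "g ` A \<subseteq> T" using A(1) g(2) by blast
      show "g ` A \<in> Chains r" using A(2) unfolding Chains_def R_def by blast
    qed
    then show ?thesis by (rule countable_image_inj_on[OF _ inj_on_subset[OF g(1) A(1)]])
  qed
  have R_antichain: "countable A"
    if A: "A \<subseteq> ?\<Omega>" "\<And>x y. x \<in> A \<Longrightarrow> y \<in> A \<Longrightarrow> (x, y) \<in> R \<Longrightarrow> x = y" for A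
  proof -
    have "(g x, g y) \<notin> r" if "x \<in> A" "y \<in> A" "g x \<noteq> g y" for x y
      using that A(1) A(2)[of y x] unfolding R_def by auto
    then have "antichain r (g ` A)" unfolding antichain_def ball_simps by metis
    then have "countable (g ` A)" using antichain[of "g ` A"] A(1) g(2) by blast
    then show ?thesis by (rule countable_image_inj_on[OF _ inj_on_subset[OF g(1) A(1)]])
  qed
  \<comment> \<open>In the reversed order these are the tree predecessors of \<open>x\<close>, which
    form a chain.\<close>
  have below: "countable {y. (x, y) \<in> R}" for x
    by (rule R_chain) (use R_tree R_dom in blast)+
  define B where "B = {x \<in> ?\<Omega>. countable {y. (y, x) \<in> R}}"
  \<comment> \<open>Every node of \<open>B\<close> is comparable to some node of a maximal antichain of \<open>B\<close>.\<close>
  have B: "countable B"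
  proof -
    define \<A> where "\<A> = {A. A \<subseteq> B \<and> (\<forall>x\<in>A. \<forall>y\<in>A. (x, y) \<in> R \<longrightarrow> x = y)}"
    have "\<exists>A\<in>\<A>. \<forall>X\<in>\<A>. A \<subseteq> X \<longrightarrow> X = A"
    proof (rule subset_Zorn')
      fix C assume "subset.chain \<A> C"
      then have C: "C \<subseteq> \<A>" "\<And>X Y. X \<in> C \<Longrightarrow> Y \<in> C \<Longrightarrow> X \<subseteq> Y \<or> Y \<subseteq> X"
        unfolding subset_chain_def by blast+
      have "x = y" if xy: "x \<in> X" "X \<in> C" "y \<in> Y" "Y \<in> C" "(x, y) \<in> R" for x y X Y
      proof -
        obtain Z where "Z \<in> C" "x \<in> Z" "y \<in> Z" using C(2)[OF xy(2,4)] xy by blast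
        then show ?thesis using C(1) xy(5) unfolding \<A>_def by blast
      qed
      moreover have "\<Union>C \<subseteq> B" using C(1) unfolding \<A>_def by blast
      ultimately show "\<Union>C \<in> \<A>" unfolding \<A>_def by blast
    qed
    then obtain A where A: "A \<in> \<A>" and max: "\<And>X. X \<in> \<A> \<Longrightarrow> A \<subseteq> X \<Longrightarrow> X = A" by blast
    have "B \<subseteq> (\<Union>a\<in>A. {y. (y, a) \<in> R} \<union> {y. (a, y) \<in> R})"
    proof (rule subsetI, rule ccontr)
      fix b assume b: "b \<in> B" "b \<notin> (\<Union>a\<in>A. {y. (y, a) \<in> R} \<union> {y. (a, y) \<in> R})"
      then have "insert b A \<in> \<A>" using A unfolding \<A>_def by blast
      then have "b \<in> A" using max by blast
      moreover have "(b, b) \<in> R" using R_refl b(1) unfolding B_def by blast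
      ultimately show False using b(2) by blast
    qed
    moreover have "countable A"
      by (rule R_antichain) (use A in \<open>auto simp: \<A>_def B_def\<close>)
    moreover have "countable {y. (y, a) \<in> R}" if "a \<in> A" for a
      using that A unfolding \<A>_def B_def by blast
    ultimately show ?thesis
      using below by (meson countable_UN countable_Un countable_subset)
  qed
  define P where "P = set_of (?\<Omega> - B)"
  have P: "elts P = ?\<Omega> - B"
    unfolding P_def by (rule elts_set_of[OF small_subset[OF small_elts]]) blast
  define r' where "r' = Restr R (elts P)"
  have "uncountable ?\<Omega>" by (rule uncountable_omega1)
  then have "elts P \<noteq> {}" using B uncountable_minus_countable unfolding P by (metis countable_empty)
  moreover have "partial_order_on (elts P) r'"
    unfolding order_on_defs refl_on_def trans_def antisym_def r'_def
    using R_refl R_trans R_antisym P by blast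
  ultimately have "suslin_forcing P r'"
  proof (unfold_locales, goal_cases)
    case 1
    then show ?case by (simp add: forcing_poset_def)
  next
    case 2
    then show ?case unfolding P by blast
  next
    case (3 s p q)
    then show ?case using R_tree unfolding r'_def by blast
  next
    case (4 p)
    \<comment> \<open>A node outside \<open>B\<close> has an uncountable cone in \<open>R\<close>,
      and removing the countable set \<open>B\<close> keeps it uncountable.\<close>
    have "{q. (q, p) \<in> R} - B \<subseteq> {q. (q, p) \<in> r'}" using 4(3) R_dom unfolding r'_def P by blast
    moreover have "uncountable {q. (q, p) \<in> R}" using 4(3) unfolding P B_def by blast
    ultimately show ?case using B uncountable_minus_countable countable_subset by metis
  next
    case (5 A)
    show ?case by (rule R_chain) (use 5 in \<open>unfold r'_def P, blast+\<close>)
  next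
    case (6 A)
    show ?case
    proof (rule R_antichain)
      show "A \<subseteq> ?\<Omega>" using 6(3) P by blast
      fix x y assume xy: "x \<in> A" "y \<in> A" "(x, y) \<in> R"
      then have "(x, y) \<in> r'" using 6(3) unfolding r'_def by blast
      then show "x = y" using 6(4) xy by blast
    qed
  qed
  then show ?thesis by blast
qed

text \<open>The proper initial segments of \<open>omega1_card\<close> are pairwise non-isomorphic,
  so nodes whose heights are these segments are distinct.\<close>

lemma suslin_tree_uncountable:
  assumes levels: "\<And>\<alpha> :: nat set rel. \<alpha> <o omega1_card \<Longrightarrow> \<exists>t\<in>T. height r t =o \<alpha>"
  shows "uncountable T"
proof -
  let ?w = omega1_card
  interpret wo_rel ?w using Well_order_omega1_card by (simp add: wo_rel_def)
  define s where "s x = Restr ?w (Order_Relation.underS ?w x)" for x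
  have "s x <o ?w" if "x \<in> Field ?w" for x
    unfolding s_def using underS_Restr_ordLess[OF Well_order_omega1_card] that by blast
  then have "\<exists>t\<in>T. height r t =o s x" if "x \<in> Field ?w" for x using levels that by blast
  then obtain t where t: "\<And>x. x \<in> Field ?w \<Longrightarrow> t x \<in> T \<and> height r (t x) =o s x" by metis
  have less: "s x <o s y" if "(x, y) \<in> ?w" "x \<noteq> y" for x y
  proof -
    have "Order_Relation.underS ?w x \<subset> Order_Relation.underS ?w y"
      using that TRANS ANTISYM unfolding Order_Relation.underS_def
      by (auto dest: transD antisymD)
    then show ?thesis
      unfolding s_def using ofilter_subset_ordLess[OF Well_order_omega1_card] underS_ofilter by blast
  qed
  have "inj_on t (Field ?w)"
  proof (rule inj_onI, rule ccontr)
    fix x y assume *: "x \<in> Field ?w" "y \<in> Field ?w" "t x = t y" "x \<noteq> y"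
    then have "s x =o s y" using t ordIso_symmetric ordIso_transitive by metis
    moreover have "s x <o s y \<or> s y <o s x"
      using less * TOTAL unfolding total_on_def by metis
    ultimately show False using not_ordLess_ordIso ordIso_symmetric by blast
  qed
  then have "|Field ?w| \<le>o |T|" using t by (intro card_of_ordLeqI[of t]) auto
  then show ?thesis
    unfolding uncountable_iff_omega1_le
    using card_of_Field_ordIso[OF Card_order_omega1_card] ordIso_symmetric ordIso_ordLeq_trans by blast
qed

lemma suslin_tree_forcing:
  assumes "suslin_tree T r"
  shows "\<exists>(P::'v::zfc) r. suslin_forcing P r"
proof (rule suslin_forcing_exists)
  have tree: "tree_on T r" using assms unfolding suslin_tree_def by blast
  show po: "partial_order_on T r" using tree unfolding tree_on_def by blast
  show "(x, y) \<in> r \<or> (y, x) \<in> r" if "(x, z) \<in> r" "(y, z) \<in> r" for x y z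
  proof (cases "x = z \<or> y = z \<or> x = y")
    case True
    then show ?thesis using that po unfolding order_on_defs refl_on_def by blast
  next
    case False
    have "z \<in> T" using that po unfolding order_on_defs by blast
    then have "total_on (underS r z) (height r z)"
      using tree unfolding tree_on_def order_on_defs by blast
    then show ?thesis using that False unfolding total_on_def height_def underS_def by blast
  qed
  show "uncountable T"
    by (rule suslin_tree_uncountable) (use assms in \<open>auto simp: suslin_tree_def\<close>)
qed (use assms in \<open>auto simp: suslin_tree_def\<close>)

text \<open>Choose intervals \<open>(a \<alpha>, b \<alpha>)\<close> with a point \<open>c \<alpha>\<close>, for \<open>\<alpha> < \<omega>\<^sub>1\<close>, avoiding the countably many
  points \<open>a \<beta>\<close>, \<open>b \<beta>\<close>, \<open>c \<beta>\<close> with \<open>\<beta> < \<alpha>\<close>, which are not dense. Then two of the intervals are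
  disjoint or nested. In an uncountable chain, uncountably many intervals have all later ones on
  the same side of \<open>c \<alpha>\<close>, and their other halves are disjoint.\<close>

lemma suslin_line_forcing:
  assumes "suslin_line L r"
  shows "\<exists>(P::'v::zfc) r. suslin_forcing P r"
proof -
  let ?\<Omega> = "elts (omega1 :: 'v)"
  have lin: "linear_order_on L r"
    and dense: "\<And>a b. (a, b) \<in> r - Id \<Longrightarrow> open_interval r a b \<noteq> {}"
    and disj: "\<And>U. U \<subseteq> nonempty_intervals r \<Longrightarrow> pairwise disjnt U \<Longrightarrow> countable U"
    using assms unfolding suslin_line_def by simp_all
  have nonsep: "\<exists>J\<in>nonempty_intervals r. D \<inter> J = {}" if "D \<subseteq> L" "countable D" for D
  proof (rule ccontr)
    assume "\<not> ?thesis"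
    then have "\<exists>D\<subseteq>L. countable D \<and> (\<forall>J\<in>nonempty_intervals r. D \<inter> J \<noteq> {})" using that by blast
    then show False using assms unfolding suslin_line_def by simp
  qed
  define lt where "lt x y \<longleftrightarrow> (x, y) \<in> r - Id" for x y
  have lt_L: "x \<in> L" "y \<in> L" if "lt x y" for x y
    using that lin unfolding lt_def order_on_defs by blast+
  have lt_trans: "lt x z" if "lt x y" "lt y z" for x y z
    using that lin unfolding lt_def order_on_defs trans_def antisym_def by blast
  have lt_irrefl: "\<not> lt x x" for x unfolding lt_def by blast
  have lt_linear: "lt x y \<or> x = y \<or> lt y x" if "x \<in> L" "y \<in> L" for x y
    using that lin unfolding lt_def order_on_defs total_on_def by blast
  have interval: "x \<in> open_interval r a b \<longleftrightarrow> lt a x \<and> lt x b" for a b x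
    unfolding open_interval_def lt_def by blast
  have nonempty: "open_interval r a b \<in> nonempty_intervals r" if "x \<in> open_interval r a b" for a b x
    using that unfolding nonempty_intervals_def by blast
  \<comment> \<open>Intervals are convex: a point with elements of the interval on both sides would
    lie in it.\<close>
  have side: "(\<forall>u\<in>open_interval r a b. lt u z) \<or> (\<forall>u\<in>open_interval r a b. lt z u)"
    if "z \<in> L" "z \<notin> open_interval r a b" for a b z
  proof (rule ccontr)
    assume "\<not> ?thesis"
    then obtain u v where uv: "u \<in> open_interval r a b" "\<not> lt u z" "v \<in> open_interval r a b" "\<not> lt z v"
      by blast
    then have "u \<in> L" "v \<in> L" using lt_L unfolding interval by blast+
    then have "lt z u" "lt v z" using uv that lt_linear by metis+
    then have "lt z b" "lt a z" using uv lt_trans unfolding interval by blast+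
    then show False using that(2) interval by blast
  qed
  have countable_index: "countable A"
    if "\<And>x. x \<in> A \<Longrightarrow> K x \<in> nonempty_intervals r"
      "\<And>x y. x \<in> A \<Longrightarrow> y \<in> A \<Longrightarrow> x \<noteq> y \<Longrightarrow> K x \<inter> K y = {}" for A :: "'v set" and K
  proof -
    have ne: "K x \<noteq> {}" if "x \<in> A" for x
      using \<open>\<And>x. x \<in> A \<Longrightarrow> K x \<in> _\<close>[OF that] unfolding nonempty_intervals_def by blast
    have "countable (K ` A)"
      by (rule disj) (use that in \<open>auto simp: pairwise_def disjnt_def\<close>)
    moreover have "inj_on K A" using that(2) ne by (intro inj_onI) (metis Int_absorb)
    ultimately show ?thesis using countable_image_inj_on by blast
  qed
  \<comment> \<open>The recursion runs along membership through the whole universe, so the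
    requirement is guarded by countability of \<open>x\<close>. Every element of
    \<open>omega1\<close> satisfies the guard.\<close>
  define good where "good h x t \<longleftrightarrow> (case t of (a, b, c) \<Rightarrow> countable (elts x) \<longrightarrow>
      c \<in> open_interval r a b \<and> (\<forall>y\<in>elts x. case h y of (a', b', c') \<Rightarrow>
        a' \<notin> open_interval r a b \<and> b' \<notin> open_interval r a b \<and> c' \<notin> open_interval r a b))"
    for h :: "'v \<Rightarrow> _" and x t
  have "\<exists>h. \<forall>x. good h x (h x)"
  proof (rule dependent_wf_choice[OF foundation])
    show "good h x t = good h' x t" if "\<And>z. (z, x) \<in> {(x, y). x \<in> elts y} \<Longrightarrow> h z = h' z" for h h' x t
      using that unfolding good_def by auto
    show "\<exists>t. good h x t" for x and h :: "'v \<Rightarrow> _"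
    proof (cases "countable (elts x)")
      case True
      \<comment> \<open>At this point the earlier values \<open>h y\<close> are arbitrary, so they
        are cut down to \<open>L\<close> to make \<open>nonsep\<close> applicable.\<close>
      define D where "D = L \<inter> (\<Union>y\<in>elts x. case h y of (a, b, c) \<Rightarrow> {a, b, c})"
      have "countable D" unfolding D_def using True by (auto split: prod.split)
      then obtain J where J: "J \<in> nonempty_intervals r" "D \<inter> J = {}" using nonsep[of D] D_def by blast
      then obtain a b c where abc: "J = open_interval r a b" "c \<in> J"
        unfolding nonempty_intervals_def by blast
      have "J \<subseteq> L" using abc(1) interval lt_L by blast
      then have "z \<notin> J" if "y \<in> elts x" "h y = (a', b', c')" "z \<in> {a', b', c'}" for y a' b' c' z
        using J(2) that unfolding D_def by fastforce
      then have "good h x (a, b, c)" using abc unfolding good_def by (auto split: prod.split)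
      then show ?thesis by blast
    qed (auto simp: good_def)
  qed
  then obtain h where h: "\<And>x. good h x (h x)" by blast
  define a b c where "a x = fst (h x)" and "b x = fst (snd (h x))" and "c x = snd (snd (h x))" for x
  define J where "J x = open_interval r (a x) (b x)" for x
  have hJ: "c x \<in> J x" "\<And>y. y \<in> elts x \<Longrightarrow> a y \<notin> J x \<and> b y \<notin> J x \<and> c y \<notin> J x" if "x \<in> ?\<Omega>" for x
    using h[of x] countable_in_omega1[OF that]
    unfolding good_def J_def a_def b_def c_def by (simp_all add: case_prod_beta)
  have J_lt: "lt (a x) u" "lt u (b x)" if "u \<in> J x" for u x using that unfolding J_def interval by auto
  have abc_L: "a x \<in> L" "b x \<in> L" "c x \<in> L" if "x \<in> ?\<Omega>" for x
    using J_lt[OF hJ(1)[OF that]] lt_L by blast+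
  \<comment> \<open>The endpoints of \<open>J y\<close> are not in \<open>J x\<close>, so each has
    all of \<open>J x\<close> on one side. A common point lies between them, and this determines the
    sides.\<close>
  have nested: "J x \<subseteq> J y" if xy: "x \<in> ?\<Omega>" "y \<in> elts x" "J x \<inter> J y \<noteq> {}" for x y
  proof -
    have y: "y \<in> ?\<Omega>" using Ord_trans[OF Ord_omega1] xy by blast
    obtain u where u: "u \<in> J x" "u \<in> J y" using xy(3) by blast
    have "\<forall>v\<in>J x. lt (a y) v"
      using side[OF abc_L(1)[OF y], of "a x" "b x"] hJ(2)[OF xy(1,2)] u J_lt(1)[OF u(2)]
        lt_trans lt_irrefl unfolding J_def by blast
    moreover have "\<forall>v\<in>J x. lt v (b y)"
      using side[OF abc_L(2)[OF y], of "a x" "b x"] hJ(2)[OF xy(1,2)] u J_lt(2)[OF u(2)]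
        lt_trans lt_irrefl unfolding J_def by blast
    ultimately show ?thesis unfolding J_def using interval[of _ "a y" "b y"] by blast
  qed
  \<comment> \<open>Larger intervals with earlier indices come first. The clause on indices makes
    antisymmetry a consequence of \<open>mem_asym\<close>.\<close>
  define R where "R = {(y, x). y \<in> ?\<Omega> \<and> x \<in> ?\<Omega> \<and> (y = x \<or> y \<in> elts x) \<and> J x \<subseteq> J y}"
  have comparable: "(x, y) \<in> R \<or> (y, x) \<in> R" if "x \<in> ?\<Omega>" "y \<in> ?\<Omega>" "J x \<inter> J y \<noteq> {}" for x y
    using Ord_linear[of x y] Ord_in_Ord[OF Ord_omega1] that nested unfolding R_def by blast
  show ?thesis
  proof (rule suslin_forcing_exists)
    have "trans R" unfolding R_def trans_def using Ord_trans Ord_in_Ord[OF Ord_omega1] by blast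
    moreover have "antisym R" unfolding R_def antisym_def using mem_asym by blast
    moreover have "R \<subseteq> ?\<Omega> \<times> ?\<Omega>" "refl_on ?\<Omega> R" unfolding R_def refl_on_def by blast+
    ultimately show "partial_order_on ?\<Omega> R" unfolding order_on_defs by blast
    show "(x, y) \<in> R \<or> (y, x) \<in> R" if "(x, z) \<in> R" "(y, z) \<in> R" for x y z
      by (rule comparable) (use that hJ(1) in \<open>auto simp: R_def\<close>)
    show "uncountable ?\<Omega>" by (rule uncountable_omega1)
    show "countable A" if A: "A \<subseteq> ?\<Omega>" "antichain R A" for A
    proof (rule countable_index[of A J])
      show "J x \<in> nonempty_intervals r" if "x \<in> A" for x
        unfolding J_def using nonempty hJ(1) that A(1) unfolding J_def by blast
      show "J x \<inter> J y = {}" if "x \<in> A" "y \<in> A" "x \<noteq> y" for x y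
        using comparable[of x y] A that unfolding antichain_def by blast
    qed
    show "countable A" if A: "A \<subseteq> ?\<Omega>" "A \<in> Chains R" for A
    proof -
      define A1 where "A1 = {x \<in> A. \<forall>y\<in>A. x \<in> elts y \<longrightarrow> (\<forall>u\<in>J y. lt u (c x))}"
      define A2 where "A2 = {x \<in> A. \<forall>y\<in>A. x \<in> elts y \<longrightarrow> (\<forall>u\<in>J y. lt (c x) u)}"
      have c: "lt (a x) (c x)" "lt (c x) (b x)" if "x \<in> A" for x
        using J_lt hJ(1) that A(1) by blast+
      have linear: "x \<in> elts y \<or> y \<in> elts x" if "x \<in> A" "y \<in> A" "x \<noteq> y" for x y
        using that A Ord_linear Ord_in_Ord[OF Ord_omega1] by blast
      have "countable A1"
      proof (rule countable_index[of A1 "\<lambda>x. open_interval r (c x) (b x)"])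
        show "open_interval r (c x) (b x) \<in> nonempty_intervals r" if "x \<in> A1" for x
          using c(2)[of x] that dense nonempty unfolding A1_def lt_def by blast
        \<comment> \<open>The later interval \<open>J y\<close> lies entirely to the left of
          \<open>c x\<close>, so it misses the right half of \<open>J x\<close>.\<close>
        have "open_interval r (c x) (b x) \<inter> open_interval r (c y) (b y) = {}"
          if "x \<in> A1" "y \<in> A1" "x \<in> elts y" for x y
        proof -
          have "open_interval r (c y) (b y) \<subseteq> J y"
            using c(1)[of y] that(2) lt_trans unfolding J_def A1_def subset_iff interval by blast
          then have "\<forall>u\<in>open_interval r (c y) (b y). lt u (c x)" using that unfolding A1_def by blast
          then show ?thesis using lt_trans lt_irrefl interval by blast
        qed
        then show "open_interval r (c x) (b x) \<inter> open_interval r (c y) (b y) = {}"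
          if "x \<in> A1" "y \<in> A1" "x \<noteq> y" for x y
          using that linear[of x y] unfolding A1_def by (metis (no_types, lifting) Int_commute mem_Collect_eq)
      qed
      moreover have "countable A2"
      proof (rule countable_index[of A2 "\<lambda>x. open_interval r (a x) (c x)"])
        show "open_interval r (a x) (c x) \<in> nonempty_intervals r" if "x \<in> A2" for x
          using c(1)[of x] that dense nonempty unfolding A2_def lt_def by blast
        have "open_interval r (a x) (c x) \<inter> open_interval r (a y) (c y) = {}"
          if "x \<in> A2" "y \<in> A2" "x \<in> elts y" for x y
        proof -
          have "open_interval r (a y) (c y) \<subseteq> J y"
            using c(2)[of y] that(2) lt_trans unfolding J_def A2_def subset_iff interval by blast
          then have "\<forall>u\<in>open_interval r (a y) (c y). lt (c x) u" using that unfolding A2_def by blast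
          then show ?thesis using lt_trans lt_irrefl interval by blast
        qed
        then show "open_interval r (a x) (c x) \<inter> open_interval r (a y) (c y) = {}"
          if "x \<in> A2" "y \<in> A2" "x \<noteq> y" for x y
          using that linear[of x y] unfolding A2_def by (metis (no_types, lifting) Int_commute mem_Collect_eq)
      qed
      moreover have "A \<subseteq> A1 \<union> A2"
      proof (rule subsetI, rule ccontr)
        fix x assume x: "x \<in> A" "x \<notin> A1 \<union> A2"
        have c_side: "(\<forall>u\<in>J y. lt u (c x)) \<or> (\<forall>u\<in>J y. lt (c x) u)" if "y \<in> A" "x \<in> elts y" for y
          using side[OF abc_L(3), of x "a y" "b y"] hJ(2)[of y x] that x A(1) unfolding J_def by blast
        \<comment> \<open>Failing both definitions, \<open>x\<close> has a later \<open>J y\<close>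
          to the right of \<open>c x\<close> and a later \<open>J z\<close> to the left of it. These
          are disjoint, whereas members of a chain are nested.\<close>
        obtain y z where yz: "y \<in> A" "\<forall>u\<in>J y. lt (c x) u" "z \<in> A" "\<forall>u\<in>J z. lt u (c x)"
          using x c_side unfolding A1_def A2_def by blast
        have "(y, z) \<in> R \<or> (z, y) \<in> R" using yz(1,3) A(2) unfolding Chains_def by simp
        then have "J y \<subseteq> J z \<or> J z \<subseteq> J y" unfolding R_def by auto
        moreover have "c y \<in> J y" "c z \<in> J z" using hJ(1) yz A(1) by blast+
        ultimately show False using yz(2,4) lt_trans lt_irrefl by blast
      qed
      ultimately show ?thesis by (meson countable_Un countable_subset)
    qed
  qed
qed

theorem corollary3p8:
  assumes "IGMP_omega2 TYPE('v::zfc)"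
  shows "\<not> (\<exists>(T::'v) r. suslin_tree (elts T) r) \<and> suslin_hypothesis TYPE('v)"
  using IGMP_omega2_no_suslin_forcing[OF assms] suslin_tree_forcing suslin_line_forcing
  unfolding suslin_hypothesis_def by blast

end
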